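(* Let $S\subset\partial\mathbb{D}$ be a nonempty closed subset. Then $\mathbb{D}$ (identified with its image in $\mathcal{M}(A_S)$ under $z\mapsto(f\mapsto f(z))$) is dense in $\mathcal{M}(A_S)$.
   Context: $\mathbb{D}\subset\mathbb{C}$ is the open unit disk. $H^\infty$ is the algebra of bounded holomorphic functions on $\mathbb{D}$ and $A_0\subset H^\infty$ is the disk algebra (functions continuous on $\overline{\mathbb{D}}$ and holomorphic in $\mathbb{D}$). If $S$ contains at least two points, $A_S\subset H^\infty$ is the uniform closure of the algebra generated by $A_0$ and by holomorphic functions on $\mathbb{D}$ of the form $e^f$ where $\mathrm{Re}\,f|_{\partial\mathbb{D}}$ is a finite linear combination with real coefficients of characteristic functions of closed arcs whose endpoints belong to $S$. If $S$ is a single point, $A_S\subset H^\infty$ is the uniform closure of the algebra generated by $A_0$ and the functions $ge^{\lambda f}$, $\lambda\in\mathbb{R}$, where $\mathrm{Re}\,f|_{\partial\mathbb{D}}$ is the characteristic function of a closed arc with an endpoint at $S$ and $g\in A_0$ is a function such that $ge^f$ has a discontinuity on $S$ only. Here $f$ is holomorphic on $\mathbb{D}$ and $\mathrm{Re}\,f$ is the Poisson integral of its boundary function $\mathrm{Re}\,f|_{\partial\mathbb{D}}$. $\mathcal{M}(A_S)$ is the maximal ideal space of $A_S$: the set of characters (nonzero homomorphisms $A_S\to\mathbb{C}$) with the weak$^*$ (Gelfand) topology. *)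

theory Defs
  imports "HOL-Complex_Analysis.Complex_Analysis"
begin

text \<open>
  Functions on the open unit disk are represented by total functions on the complex plane
  that vanish off the disk, so that two functions are equal iff they agree on the disk.
  These are closed under the pointwise operations.
\<close>

abbreviation unit_disk :: "complex set" where
  "unit_disk \<equiv> ball 0 1"

abbreviation unit_circle :: "complex set" where
  "unit_circle \<equiv> sphere 0 1"

definition on_disk :: "(complex \<Rightarrow> complex) \<Rightarrow> complex \<Rightarrow> complex" where
  "on_disk h = (\<lambda>z. if z \<in> unit_disk then h z else 0)"

definition Hinf :: "(complex \<Rightarrow> complex) set" where
  "Hinf = {h. h holomorphic_on unit_disk \<and> bounded (h ` unit_disk) \<and> (\<forall>z. z \<notin> unit_disk \<longrightarrow> h z = 0)}"

definition disk_algebra :: "(complex \<Rightarrow> complex) set" where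
  "disk_algebra =
     {on_disk h | h. continuous_on (cball 0 1) h \<and> h holomorphic_on unit_disk}"

definition poisson_kernel :: "complex \<Rightarrow> real \<Rightarrow> real" where
  "poisson_kernel z t = (1 - (norm z)\<^sup>2) / (norm (cis t - z))\<^sup>2"

definition poisson_integral :: "(complex \<Rightarrow> real) \<Rightarrow> complex \<Rightarrow> real" where
  "poisson_integral u z =
     1 / (2 * pi) * (LBINT t:{0..2 * pi}. poisson_kernel z t * u (cis t))"

definition holo_with_boundary_Re :: "(complex \<Rightarrow> complex) \<Rightarrow> (complex \<Rightarrow> real) \<Rightarrow> bool" where
  "holo_with_boundary_Re f u \<longleftrightarrow>
     f holomorphic_on unit_disk \<and> (\<forall>z\<in>unit_disk. Re (f z) = poisson_integral u z)"

text \<open>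
  The closed arc running counterclockwise from \<open>cis a\<close> to \<open>cis b\<close>; it is always used with
  \<open>a < b < a + 2 * pi\<close>, so that it is nondegenerate with two distinct endpoints. (Single points
  and the full circle have Poisson integral 0 and 1 and would only contribute constants.)
\<close>

definition closed_arc :: "real \<Rightarrow> real \<Rightarrow> complex set" where
  "closed_arc a b = cis ` {a..b}"

definition arc_step_function :: "complex set \<Rightarrow> (complex \<Rightarrow> real) \<Rightarrow> bool" where
  "arc_step_function S u \<longleftrightarrow>
     (\<exists>(n::nat) (c::nat \<Rightarrow> real) (a::nat \<Rightarrow> real) (b::nat \<Rightarrow> real).
        (\<forall>i<n. a i < b i \<and> b i < a i + 2 * pi \<and> cis (a i) \<in> S \<and> cis (b i) \<in> S) \<and>
        u = (\<lambda>\<zeta>. \<Sum>i<n. c i * indicator (closed_arc (a i) (b i)) \<zeta>))"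

text \<open>
  A boundary point is a discontinuity of a function on the disk if the function has no
  continuous extension to that point.
\<close>

definition boundary_discontinuities :: "(complex \<Rightarrow> complex) \<Rightarrow> complex set" where
  "boundary_discontinuities h =
     {\<zeta> \<in> unit_circle. \<not> (\<exists>l. (h \<longlongrightarrow> l) (at \<zeta> within unit_disk))}"

definition exp_generators :: "complex set \<Rightarrow> (complex \<Rightarrow> complex) set" where
  "exp_generators S =
     {on_disk (\<lambda>z. exp (f z)) | f. \<exists>u. arc_step_function S u \<and> holo_with_boundary_Re f u}"

definition point_generators :: "complex set \<Rightarrow> (complex \<Rightarrow> complex) set" where
  "point_generators S =
     {on_disk (\<lambda>z. g z * exp (of_real lam * f z)) | g (lam::real) f.
        g \<in> disk_algebra \<and>
        (\<exists>a b. a < b \<and> b < a + 2 * pi \<and> (cis a \<in> S \<or> cis b \<in> S) \<and>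
               holo_with_boundary_Re f (indicator (closed_arc a b))) \<and>
        boundary_discontinuities (\<lambda>z. g z * exp (f z)) = S}"

inductive_set generated_algebra :: "(complex \<Rightarrow> complex) set \<Rightarrow> (complex \<Rightarrow> complex) set"
  for G :: "(complex \<Rightarrow> complex) set" where
  gen: "h \<in> G \<Longrightarrow> h \<in> generated_algebra G"
| add: "h \<in> generated_algebra G \<Longrightarrow> k \<in> generated_algebra G \<Longrightarrow>
          (\<lambda>z. h z + k z) \<in> generated_algebra G"
| scale: "h \<in> generated_algebra G \<Longrightarrow> (\<lambda>z. c * h z) \<in> generated_algebra G"
| mult: "h \<in> generated_algebra G \<Longrightarrow> k \<in> generated_algebra G \<Longrightarrow>
          (\<lambda>z. h z * k z) \<in> generated_algebra G"

definition uniform_closure :: "(complex \<Rightarrow> complex) set \<Rightarrow> (complex \<Rightarrow> complex) set" where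
  "uniform_closure B =
     {h \<in> Hinf. \<exists>k. (\<forall>n. k n \<in> B) \<and> uniform_limit unit_disk k h sequentially}"

definition A_alg :: "complex set \<Rightarrow> (complex \<Rightarrow> complex) set" where
  "A_alg S = uniform_closure (generated_algebra
     (disk_algebra \<union> (if is_singleton S then point_generators S else exp_generators S)))"

text \<open>
  Characters of an algebra \<open>A\<close> are taken extensional on \<open>A\<close>, so that they are determined by
  their values on \<open>A\<close>; the Gelfand topology is then the topology of pointwise convergence on \<open>A\<close>.
\<close>

definition max_ideal_space ::
    "(complex \<Rightarrow> complex) set \<Rightarrow> ((complex \<Rightarrow> complex) \<Rightarrow> complex) set" where
  "max_ideal_space A =
     {\<phi> \<in> extensional A.
        (\<forall>f\<in>A. \<forall>g\<in>A. \<phi> (\<lambda>z. f z + g z) = \<phi> f + \<phi> g) \<and>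
        (\<forall>f\<in>A. \<forall>c. \<phi> (\<lambda>z. c * f z) = c * \<phi> f) \<and>
        (\<forall>f\<in>A. \<forall>g\<in>A. \<phi> (\<lambda>z. f z * g z) = \<phi> f * \<phi> g) \<and>
        (\<exists>f\<in>A. \<phi> f \<noteq> 0)}"

definition gelfand_topology ::
    "(complex \<Rightarrow> complex) set \<Rightarrow> ((complex \<Rightarrow> complex) \<Rightarrow> complex) topology" where
  "gelfand_topology A =
     subtopology (product_topology (\<lambda>_. euclidean) A) (max_ideal_space A)"

definition point_eval ::
    "(complex \<Rightarrow> complex) set \<Rightarrow> complex \<Rightarrow> ((complex \<Rightarrow> complex) \<Rightarrow> complex)" where
  "point_eval A z = restrict (\<lambda>f. f z) A"

end

theory Submission
  imports Defs
begin

text \<open>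
  Put \<open>L(s, z) = -i Ln (1 - z / s)\<close> for \<open>s\<close> on the circle. The Poisson integral of an arc from \<open>a\<close> to
  \<open>b\<close> is, up to a constant, \<open>Re (L(b, z) - L(a, z)) / pi\<close>. Hence every generator extends continuously
  to all but finitely many boundary points, and near each boundary point \<open>\<zeta>\<close> it is asymptotic to
  \<open>c exp (\<lambda> L(\<zeta>, z))\<close> for a real \<open>\<lambda>\<close>; as soon as some generator has \<open>c \<lambda> \<noteq> 0\<close>, the algebra contains
  for every real \<open>\<mu>\<close> a function \<open>H\<^sub>\<mu>\<close> asymptotic to \<open>exp (\<mu> L(\<zeta>, z))\<close>.

  Let \<open>\<phi>\<close> be a character and \<open>\<zeta> = \<phi>(z)\<close>. If \<open>\<zeta>\<close> is in the open disk, \<open>\<phi>\<close> is evaluation at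
  \<open>\<zeta>\<close> on the generators. Otherwise \<open>|\<phi>(h)|\<close> is at most the upper limit of \<open>|h|\<close> at \<open>\<zeta>\<close>, so
  \<open>\<phi>\<close> is determined on the generators by the homomorphism \<open>\<mu> \<mapsto> \<phi>(H\<^sub>\<mu>)\<close> from the reals to the
  nonzero complex numbers. The same bound shows that its modulus is \<open>exp (\<mu> x)\<close> with \<open>|x| \<le>
  pi / 2\<close>, and by Kronecker's theorem its unitary part is approximated on finitely many \<open>\<mu>\<close>
  by \<open>exp (i \<mu> t)\<close> with arbitrarily large \<open>t\<close>. The points \<open>z\<close> with \<open>L(\<zeta>, z) = x' + i t\<close>,
  \<open>|x'| < pi / 2\<close>, \<open>x'\<close> close to \<open>x\<close>, then approximate \<open>\<phi>\<close>.
\<close>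

section \<open>Poisson integrals of arcs\<close>

text \<open>With \<open>w = 1 - z / s\<close>, the real part is the argument of \<open>w\<close> and
  the imaginary part is \<open>- ln (norm w)\<close>. So the disk is mapped into the strip of real
  parts between -pi/2 and pi/2, and the imaginary part tends to infinity at
  \<open>s\<close>.\<close>

definition log_angle :: "complex \<Rightarrow> complex \<Rightarrow> complex" where
  "log_angle s z = - \<i> * Ln (1 - z / s)"

text \<open>The only point of the closed unit disk with real part 1 is 1 itself. This keeps the
  logarithm off its branch cut on the closed disk without \<open>s\<close>.\<close>

lemma log_angle_arg_Re_pos:
  fixes s z :: complex
  assumes "norm s = 1" "norm z \<le> 1" "z \<noteq> s"
  shows "0 < Re (1 - z / s)"
proof -
  define w where "w = z / s"
  have s: "s \<noteq> 0" using assms(1) by auto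
  have nw: "norm w \<le> 1" using assms by (simp add: w_def norm_divide)
  have w1: "w \<noteq> 1" using s assms(3) by (simp add: w_def)
  have "Re w < 1"
  proof (rule ccontr)
    assume "\<not> Re w < 1"
    with nw have re: "Re w = 1" using complex_Re_le_cmod[of w] by linarith
    have "(Re w)\<^sup>2 + (Im w)\<^sup>2 \<le> 1"
      using nw by (metis cmod_power2 norm_ge_zero power_le_one)
    then have "(Im w)\<^sup>2 \<le> 0" using re by simp
    then have "Im w = 0" by simp
    with re have "w = 1" by (simp add: complex_eq_iff)
    with w1 show False by simp
  qed
  then show ?thesis by (simp add: w_def)
qed

lemma log_angle_arg_notin_nonpos:
  fixes s z :: complex
  assumes "norm s = 1" "norm z \<le> 1" "z \<noteq> s"
  shows "1 - z / s \<notin> \<real>\<^sub>\<le>\<^sub>0"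
proof
  assume "1 - z / s \<in> \<real>\<^sub>\<le>\<^sub>0"
  then have "Re (1 - z / s) \<le> 0" by (simp only: complex_nonpos_Reals_iff)
  with log_angle_arg_Re_pos[OF assms] show False by linarith
qed

lemma Re_log_angle_bound:
  assumes "norm s = 1" "norm z < 1"
  shows "\<bar>Re (log_angle s z)\<bar> \<le> pi / 2"
proof -
  have "z \<noteq> s" using assms by auto
  then have "0 < Re (1 - z / s)" using log_angle_arg_Re_pos[of s z] assms by simp
  then show ?thesis using Re_Ln_pos_lt_imp[of "1 - z / s"] by (simp add: log_angle_def)
qed

lemma continuous_at_log_angle:
  assumes "norm s = 1" "norm z \<le> 1" "z \<noteq> s"
  shows "isCont (log_angle s) z"
proof -
  have "isCont (\<lambda>z. - \<i> * Ln (1 - z / s)) z"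
    using log_angle_arg_notin_nonpos[OF assms] assms(1) by (intro continuous_intros) auto
  then show ?thesis by (simp add: log_angle_def[abs_def])
qed

lemma holomorphic_on_log_angle:
  assumes "norm s = 1"
  shows "log_angle s holomorphic_on unit_disk"
proof -
  have "(\<lambda>z. - \<i> * Ln (1 - z / s)) holomorphic_on unit_disk"
  proof (intro holomorphic_intros)
    fix z assume "z \<in> unit_disk"
    then show "1 - z / s \<notin> \<real>\<^sub>\<le>\<^sub>0"
      using log_angle_arg_notin_nonpos[OF assms, of z] assms by force
  qed (use assms in auto)
  then show ?thesis by (simp add: log_angle_def[abs_def])
qed

lemma norm_exp_log_angle_le:
  assumes "norm s = 1" "norm z < 1"
  shows "norm (exp (of_real l * log_angle s z)) \<le> exp (\<bar>l\<bar> * (pi / 2))"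
proof -
  have "l * Re (log_angle s z) \<le> \<bar>l\<bar> * \<bar>Re (log_angle s z)\<bar>"
    by (metis abs_ge_self abs_mult)
  also have "\<dots> \<le> \<bar>l\<bar> * (pi / 2)"
    using Re_log_angle_bound[OF assms] by (intro mult_left_mono) auto
  finally show ?thesis by simp
qed

lemma cis_diff_nonzero: "norm z < 1 \<Longrightarrow> cis t - z \<noteq> 0"
  by (metis eq_iff_diff_eq_0 less_irrefl norm_cis)

text \<open>The complex function on the right is the Herglotz kernel, which has an explicit
  primitive in \<open>t\<close>.\<close>

lemma poisson_kernel_eq_Re:
  assumes "norm z < 1"
  shows "poisson_kernel z t = Re ((cis t + z) / (cis t - z))"
proof -
  have "(cis t + z) / (cis t - z) = ((cis t + z) * cnj (cis t - z)) / of_real ((norm (cis t - z))\<^sup>2)"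
    using cis_diff_nonzero[OF assms, of t]
    by (metis complex_div_cnj complex_norm_square of_real_power)
  also have "Re \<dots> = Re ((cis t + z) * cnj (cis t - z)) / (norm (cis t - z))\<^sup>2"
    by (rule Re_divide_of_real)
  also have "Re ((cis t + z) * cnj (cis t - z)) = 1 - (norm z)\<^sup>2"
    using sin_cos_squared_add[of t]
    by (simp add: cmod_power2) (simp add: power2_eq_square algebra_simps)
  finally show ?thesis by (simp add: poisson_kernel_def)
qed

text \<open>The Herglotz kernel equals 1 + 2 z / (cis t - z), and the second summand is the
  derivative in \<open>t\<close> of -2 i Ln (1 - z / cis t).\<close>

lemma log_angle_cis_has_vector_derivative:
  assumes "norm z < 1"
  shows "((\<lambda>t. of_real t + 2 * log_angle (cis t) z) has_vector_derivative
           (cis t + z) / (cis t - z)) (at t within X)"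
proof -
  \<comment> \<open>Rewritten so that \<open>t\<close> can be replaced by a complex variable
    \<open>w\<close>: the complex derivative is computed first and then restricted to the real
    line.\<close>
  have eq: "(\<lambda>t. of_real t + 2 * log_angle (cis t) z)
      = (\<lambda>t. of_real t - 2 * \<i> * Ln (1 - z * exp (- \<i> * of_real t)))"
    by (simp add: log_angle_def fun_eq_iff cis_conv_exp exp_minus divide_inverse)
  have c: "exp (- \<i> * of_real t) = inverse (cis t)"
    by (simp add: cis_conv_exp exp_minus)
  have nz: "1 - z * exp (- \<i> * of_real t) \<notin> \<real>\<^sub>\<le>\<^sub>0"
  proof -
    have "cis t \<noteq> z" using cis_diff_nonzero[OF assms, of t] by auto
    then show ?thesis
      using log_angle_arg_notin_nonpos[of "cis t" z] assms c by (simp add: divide_inverse)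
  qed
  have d: "((\<lambda>w. w - 2 * \<i> * Ln (1 - z * exp (- \<i> * w))) has_field_derivative
       1 - 2 * \<i> * (inverse (1 - z * exp (- \<i> * of_real t)) * (- (z * (exp (- \<i> * of_real t) * (- \<i>))))))
       (at (of_real t))"
    using nz by - (rule derivative_eq_intros refl | simp add: divide_inverse mult.commute)+
  have "1 - 2 * \<i> * (inverse (1 - z * exp (- \<i> * of_real t)) * (- (z * (exp (- \<i> * of_real t) * (- \<i>)))))
      = (cis t + z) / (cis t - z)"
  proof -
    have alg: "1 - 2 * \<i> * (inverse (1 - z * inverse u) * (- (z * (inverse u * (- \<i>))))) = (u + z) / (u - z)"
      if "u \<noteq> 0" "u - z \<noteq> 0" for u
    proof -
      have "1 - z * inverse u = (u - z) / u" using that by (simp add: field_simps)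
      moreover have "2 * \<i> * (inverse ((u - z) / u) * (- (z * (inverse u * (- \<i>))))) = - (2 * z / (u - z))"
        using that by (simp add: divide_simps)
      ultimately show ?thesis using that by (simp add: divide_simps)
    qed
    show ?thesis
      unfolding c by (rule alg[OF cis_neq_zero cis_diff_nonzero[OF assms]])
  qed
  with d have "((\<lambda>w. w - 2 * \<i> * Ln (1 - z * exp (- \<i> * w))) has_field_derivative
      (cis t + z) / (cis t - z)) (at (of_real t))" by simp
  then show ?thesis unfolding eq by (rule has_vector_derivative_real_field)
qed

lemma has_integral_poisson_kernel:
  assumes "norm z < 1" "p \<le> q"
  shows "(poisson_kernel z has_integral
           (q - p) + 2 * Re (log_angle (cis q) z - log_angle (cis p) z)) {p..q}"
proof -
  have "((\<lambda>t. (cis t + z) / (cis t - z)) has_integral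
          (of_real q + 2 * log_angle (cis q) z) - (of_real p + 2 * log_angle (cis p) z)) {p..q}"
    using log_angle_cis_has_vector_derivative[OF assms(1)] assms(2)
    by (intro fundamental_theorem_of_calculus) auto
  from has_integral_linear[OF this bounded_linear_Re]
  have "((\<lambda>t. Re ((cis t + z) / (cis t - z))) has_integral
          Re ((of_real q + 2 * log_angle (cis q) z) - (of_real p + 2 * log_angle (cis p) z))) {p..q}"
    by (simp only: o_def)
  moreover have "(\<lambda>t. Re ((cis t + z) / (cis t - z))) = poisson_kernel z"
    by (rule ext) (rule poisson_kernel_eq_Re[OF assms(1), symmetric])
  ultimately show ?thesis by (simp add: algebra_simps)
qed

lemma continuous_on_poisson_kernel:
  "norm z < 1 \<Longrightarrow> continuous_on X (poisson_kernel z)"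
  unfolding poisson_kernel_def
  by (intro continuous_intros) (auto simp: cis_diff_nonzero)

lemma cis_add_2pi_int: "cis (t + 2 * pi * of_int k) = cis t"
  by (simp add: cis_mult[symmetric])

lemma cis_eq_cisD:
  assumes "cis x = cis y"
  obtains n :: int where "x = y + 2 * pi * of_int n"
proof -
  have "sin x = sin y \<and> cos x = cos y" using assms by (metis cis.sel)
  then obtain n :: int where "x = y + 2 * pi * of_int n"
    using sin_cos_eq_iff by (auto simp: algebra_simps)
  then show thesis by (rule that)
qed

lemma closed_arc_shift:
  "closed_arc (a + 2 * pi * of_int k) (b + 2 * pi * of_int k) = closed_arc a b"
proof -
  have "{a + 2 * pi * of_int k..b + 2 * pi * of_int k} = (\<lambda>t. t + 2 * pi * of_int k) ` {a..b}"
    by simp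
  then show ?thesis by (simp only: closed_arc_def image_image cis_add_2pi_int)
qed

lemma closed_closed_arc: "closed (closed_arc a b)"
  unfolding closed_arc_def
  by (intro compact_imp_closed compact_continuous_image continuous_intros compact_Icc)

lemma set_integrable_poisson_indicator:
  assumes "norm z < 1"
  shows "set_integrable lborel {0..2*pi} (\<lambda>t. poisson_kernel z t * indicator (closed_arc a b) (cis t))"
proof -
  have "closed (cis -` closed_arc a b)"
    by (intro continuous_closed_vimage closed_closed_arc continuous_intros)
  then have m: "cis -` closed_arc a b \<in> sets lborel" by simp
  have "set_integrable lborel {0..2*pi} (poisson_kernel z)"
    by (intro borel_integrable_atLeastAtMost' continuous_on_poisson_kernel assms)
  from integrable_mult_indicator[OF m, OF this[unfolded set_integrable_def]]
  show ?thesis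
    unfolding set_integrable_def
    by (rule back_subst[of "integrable lborel"]) (auto simp: indicator_def)
qed

text \<open>Up to a null set, the parameters of the arc in \<open>{0..2*pi}\<close> are
  \<open>{a..b}\<close>, or two intervals if the arc runs past 2 pi. The primitive of the kernel is
  evaluated on each piece; the logarithms at 0 and 2 pi cancel by periodicity.\<close>

lemma poisson_integral_arc_aux:
  assumes z: "norm z < 1" and ab: "0 \<le> a" "a < 2 * pi" "a < b" "b < a + 2 * pi"
  shows "poisson_integral (indicator (closed_arc a b)) z
           = (b - a) / (2 * pi) + Re (log_angle (cis b) z - log_angle (cis a) z) / pi"
proof -
  let ?A = "{t \<in> {0..2*pi}. cis t \<in> closed_arc a b}"
  \<comment> \<open>Both cases at once: the second interval is empty when
    \<open>b < 2 * pi\<close>.\<close>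
  let ?B = "({a..b} \<union> {0..b - 2 * pi}) \<inter> {0..2*pi}"
  define I where "I = (b - a) + 2 * Re (log_angle (cis b) z - log_angle (cis a) z)"
  have BA: "t \<in> ?A" if "t \<in> ?B" for t
  proof -
    have "cis t = cis (t + 2 * pi)" by (simp add: cis_mult[symmetric])
    moreover have "t \<in> {a..b} \<or> t + 2 * pi \<in> {a..b}" using that ab by auto
    ultimately have "cis t \<in> closed_arc a b" unfolding closed_arc_def by (metis image_eqI)
    then show ?thesis using that by simp
  qed
  \<comment> \<open>The two ends are set aside because an arc starting at \<open>a = 0\<close> also
    contains the point with parameter 2 pi, which \<open>?B\<close> can miss. They form a null
    set.\<close>
  have AB: "t \<in> ?B" if t: "t \<in> ?A" and "t \<noteq> 0" "t \<noteq> 2 * pi" for t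
  proof -
    obtain r where r: "r \<in> {a..b}" "cis t = cis r" using t unfolding closed_arc_def by auto
    obtain n where n: "t = r + 2 * pi * of_int n" by (rule cis_eq_cisD[OF r(2)])
    have tb: "0 < t" "t < 2 * pi" using that by auto
    \<comment> \<open>Since \<open>r\<close> lies between 0 and 4 pi and \<open>t\<close> strictly
      between 0 and 2 pi, only the shifts 0 and -1 are possible.\<close>
    have "2 * pi * of_int n < 2 * pi * 1" "2 * pi * of_int n > 2 * pi * (-2)"
      using n tb r ab unfolding atLeastAtMost_iff by linarith+
    then have "of_int n < (1::real)" "of_int n > (-2::real)"
      by (simp_all only: mult_less_cancel_left_pos pi_gt_zero zero_less_mult_iff zero_less_numeral
            simp_thms)
    then have "n = 0 \<or> n = -1" by linarith
    then show ?thesis using n r tb by auto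
  qed
  have "(poisson_kernel z has_integral I) ?B"
  proof (cases "b < 2 * pi")
    case True
    then have "?B = {a..b}" using ab by auto
    then show ?thesis using has_integral_poisson_kernel[OF z, of a b] ab I_def by simp
  next
    case False
    then have B: "?B = {a..2*pi} \<union> {0..b - 2 * pi}" using ab by auto
    have "(poisson_kernel z has_integral
        ((2*pi - a) + 2 * Re (log_angle (cis (2*pi)) z - log_angle (cis a) z)) +
        ((b - 2*pi - 0) + 2 * Re (log_angle (cis (b - 2*pi)) z - log_angle (cis 0) z))) ({a..2*pi} \<union> {0..b - 2 * pi})"
    proof (rule has_integral_Un)
      have "{a..2 * pi} \<inter> {0..b - 2 * pi} = {}" using ab by auto
      then show "negligible ({a..2 * pi} \<inter> {0..b - 2 * pi})" by simp
    qed (rule has_integral_poisson_kernel[OF z]; use ab False in simp)+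
    moreover have "cis (2 * pi) = cis 0" by simp
    moreover have "cis (b - 2 * pi) = cis b" by (simp add: cis_divide[symmetric])
    ultimately show ?thesis unfolding B I_def by (simp only:) (simp add: algebra_simps)
  qed
  moreover have "(poisson_kernel z has_integral I) ?A \<longleftrightarrow> (poisson_kernel z has_integral I) ?B"
  proof (rule has_integral_spike_set_eq)
    have sub: "?A - ?B \<subseteq> {0, 2*pi}" using AB by blast
    show "negligible {x \<in> ?A - ?B. poisson_kernel z x \<noteq> 0}"
      by (rule negligible_subset[of "{0, 2*pi}"]) (use sub in auto)
    have "?B - ?A = {}" using BA by blast
    then show "negligible {x \<in> ?B - ?A. poisson_kernel z x \<noteq> 0}" by (metis (no_types, lifting) empty_iff mem_Collect_eq negligible_empty subsetI subset_empty)
  qed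
  ultimately have hA: "(poisson_kernel z has_integral I) ?A" by blast
  have "((\<lambda>t. poisson_kernel z t * indicator (closed_arc a b) (cis t)) has_integral I) {0..2*pi}"
  proof -
    have "((\<lambda>t. if t \<in> ?A then poisson_kernel z t else 0) has_integral I) {0..2*pi}"
      using hA by (subst has_integral_restrict) auto
    then show ?thesis
      by (rule has_integral_eq[rotated]) (auto simp: indicator_def)
  qed
  then have "(LBINT t:{0..2*pi}. poisson_kernel z t * indicator (closed_arc a b) (cis t)) = I"
    using set_borel_integral_eq_integral(2)[OF set_integrable_poisson_indicator[OF z, of a b]]
    by (simp add: integral_unique)
  then show ?thesis unfolding poisson_integral_def by (simp only:) (simp add: I_def field_simps)
qed

text \<open>Both sides are determined by \<open>b - a\<close> and by the parameters modulo 2 pi, so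
  the arc is first shifted by the multiple of 2 pi that brings \<open>a\<close> into the range from
  0 to 2 pi.\<close>

lemma poisson_integral_arc:
  assumes z: "norm z < 1" and ab: "a < b" "b < a + 2 * pi"
  shows "poisson_integral (indicator (closed_arc a b)) z
           = (b - a) / (2 * pi) + Re (log_angle (cis b) z - log_angle (cis a) z) / pi"
proof -
  define k where "k = - \<lfloor>a / (2 * pi)\<rfloor>"
  define a' b' where "a' = a + 2 * pi * of_int k" and "b' = b + 2 * pi * of_int k"
  have "of_int \<lfloor>a / (2 * pi)\<rfloor> \<le> a / (2 * pi)" "a / (2 * pi) < of_int \<lfloor>a / (2 * pi)\<rfloor> + 1"
    by linarith+
  then have "of_int \<lfloor>a / (2 * pi)\<rfloor> * (2 * pi) \<le> a" "a < (of_int \<lfloor>a / (2 * pi)\<rfloor> + 1) * (2 * pi)"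
    by (simp_all only: pos_le_divide_eq pos_divide_less_eq pi_gt_zero zero_less_mult_iff zero_less_numeral simp_thms)
  then have "0 \<le> a'" "a' < 2 * pi" unfolding a'_def k_def
    by (simp_all add: algebra_simps)
  with poisson_integral_arc_aux[OF z, of a' b'] ab
  show ?thesis
    unfolding a'_def b'_def closed_arc_shift cis_add_2pi_int by simp
qed

lemma poisson_integral_sum_arcs:
  assumes "norm z < 1"
  shows "poisson_integral (\<lambda>\<zeta>. \<Sum>i<n. c i * indicator (closed_arc (a i) (b i)) \<zeta>) z
           = (\<Sum>i<n. c i * poisson_integral (indicator (closed_arc (a i) (b i))) z)"
proof -
  let ?P = "\<lambda>i t. poisson_kernel z t * indicator (closed_arc (a i) (b i)) (cis t)"
  have int: "integrable lborel (\<lambda>t. indicator {0..2*pi} t *\<^sub>R ?P i t)" for i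
    using set_integrable_poisson_indicator[OF assms] by (simp add: set_integrable_def)
  have "(LBINT t:{0..2*pi}. poisson_kernel z t * (\<Sum>i<n. c i * indicator (closed_arc (a i) (b i)) (cis t)))
      = (LBINT t. (\<Sum>i<n. c i * (indicator {0..2*pi} t *\<^sub>R ?P i t)))"
    unfolding set_lebesgue_integral_def
    by (intro Bochner_Integration.integral_cong) (auto simp: sum_distrib_left algebra_simps)
  also have "\<dots> = (\<Sum>i<n. c i * (LBINT t:{0..2*pi}. ?P i t))"
    unfolding set_lebesgue_integral_def
    by (subst Bochner_Integration.integral_sum) (use int in auto)
  finally show ?thesis
    by (simp add: poisson_integral_def sum_distrib_left algebra_simps)
qed

text \<open>The difference takes values on the imaginary axis, so its image is not open, and the
  open mapping theorem makes it constant.\<close>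

lemma holomorphic_eq_Re_imp_diff_imaginary:
  assumes f: "f holomorphic_on unit_disk" and g: "g holomorphic_on unit_disk"
    and eq: "\<And>z. z \<in> unit_disk \<Longrightarrow> Re (f z) = Re (g z)"
  obtains \<beta> :: real where "\<And>z. z \<in> unit_disk \<Longrightarrow> f z = g z + \<i> * of_real \<beta>"
proof -
  define h where "h = (\<lambda>z. f z - g z)"
  have "h holomorphic_on unit_disk" unfolding h_def by (intro holomorphic_intros f g)
  moreover have Re0: "Re (h z) = 0" if "z \<in> unit_disk" for z using eq[OF that] by (simp add: h_def)
  moreover have "\<not> open (h ` unit_disk)"
  proof
    assume "open (h ` unit_disk)"
    then obtain e where e: "e > 0" "ball (h 0) e \<subseteq> h ` unit_disk"
      by (metis centre_in_ball image_eqI open_contains_ball zero_less_one)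
    have "h 0 + of_real (e/2) \<in> ball (h 0) e" using e by (simp add: dist_norm)
    then obtain w where "w \<in> unit_disk" "h w = h 0 + of_real (e/2)" using e by fastforce
    then show False using Re0[of w] Re0[of 0] e by simp
  qed
  ultimately have "h constant_on unit_disk"
    using open_mapping_thm[of h unit_disk unit_disk] by auto
  then obtain k where k: "\<And>z. z \<in> unit_disk \<Longrightarrow> h z = k" by (auto simp: constant_on_def)
  have "Re k = 0" using Re0[of 0] k[of 0] by simp
  then have "k = \<i> * of_real (Im k)" by (simp add: complex_eq_iff)
  with k have "f z = g z + \<i> * of_real (Im k)" if "z \<in> unit_disk" for z
    using that h_def by (metis add.commute diff_add_cancel)
  then show thesis by (rule that)
qed

section \<open>Bounded holomorphic functions and the disk algebra\<close>

lemma at_within_unit_disk_neq_bot: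
  assumes "norm (\<zeta>::complex) \<le> 1"
  shows "at \<zeta> within unit_disk \<noteq> bot"
proof -
  have "\<zeta> islimpt unit_disk" using islimpt_ball[of \<zeta> "0::complex" 1] assms by simp
  then show ?thesis by (simp add: trivial_limit_within)
qed

lemma eventually_in_disk: "eventually (\<lambda>z. z \<in> unit_disk) (at \<zeta> within unit_disk)"
  by (simp add: eventually_at_filter)

lemma on_disk_eqI: "(\<And>z. z \<in> unit_disk \<Longrightarrow> h z = k z) \<Longrightarrow> on_disk h = on_disk k"
  by (auto simp: on_disk_def)

lemma Hinf_add: "h \<in> Hinf \<Longrightarrow> k \<in> Hinf \<Longrightarrow> (\<lambda>z. h z + k z) \<in> Hinf"
  unfolding Hinf_def by (auto intro!: holomorphic_intros bounded_plus_comp)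

lemma Hinf_scale: "h \<in> Hinf \<Longrightarrow> (\<lambda>z. c * h z) \<in> Hinf"
  unfolding Hinf_def by (auto intro!: holomorphic_intros simp: bounded_iff norm_mult)
     (metis mult_left_mono norm_ge_zero)

lemma HinfE:
  assumes "h \<in> Hinf"
  obtains M where "M > 0" "\<And>z. norm (h z) \<le> M"
proof -
  obtain M where "M > 0" "\<forall>x\<in>h ` unit_disk. norm x \<le> M"
    using assms unfolding Hinf_def by (auto simp: bounded_pos)
  moreover have "h z = 0" if "z \<notin> unit_disk" for z using assms that by (auto simp: Hinf_def)
  ultimately show thesis by (intro that[of M]) (metis imageI norm_zero less_imp_le)+
qed

lemma HinfI:
  assumes "h holomorphic_on unit_disk" "\<And>z. z \<in> unit_disk \<Longrightarrow> norm (h z) \<le> M"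
  shows "on_disk h \<in> Hinf"
proof -
  have "bounded (h ` unit_disk)" using assms(2) unfolding bounded_iff by blast
  then have "bounded (on_disk h ` unit_disk)"
    by (rule bounded_subset) (auto simp: on_disk_def)
  moreover have "on_disk h holomorphic_on unit_disk"
    using assms(1) by (rule holomorphic_transform) (simp add: on_disk_def)
  ultimately show ?thesis by (simp add: Hinf_def on_disk_def)
qed

lemma Hinf_mult:
  assumes "h \<in> Hinf" "k \<in> Hinf"
  shows "(\<lambda>z. h z * k z) \<in> Hinf"
proof -
  obtain M where M: "M > 0" "\<And>z. norm (h z) \<le> M" by (rule HinfE[OF assms(1)]) blast
  obtain N where N: "N > 0" "\<And>z. norm (k z) \<le> N" by (rule HinfE[OF assms(2)]) blast
  have "norm (h z * k z) \<le> M * N" for z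
    unfolding norm_mult using M N by (intro mult_mono) auto
  then show ?thesis
    using assms unfolding Hinf_def by (auto intro!: holomorphic_intros simp: bounded_iff)
qed

lemma disk_algebra_Hinf: "disk_algebra \<subseteq> Hinf"
proof
  fix k assume "k \<in> disk_algebra"
  then obtain h where h: "k = on_disk h" "continuous_on (cball 0 1) h" "h holomorphic_on unit_disk"
    by (auto simp: disk_algebra_def)
  have "compact (h ` cball 0 1)" using h(2) by (intro compact_continuous_image) auto
  then obtain M where "\<forall>x\<in>h ` cball 0 1. norm x \<le> M"
    using compact_imp_bounded bounded_iff by blast
  with h show "k \<in> Hinf" by (auto intro!: HinfI[of h M])
qed

lemma disk_algebra_limit:
  assumes "k \<in> disk_algebra" "\<zeta> \<in> unit_circle"
  shows "\<exists>l. (k \<longlongrightarrow> l) (at \<zeta> within unit_disk)"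
proof -
  obtain h where h: "k = on_disk h" "continuous_on (cball 0 1) h"
    using assms by (auto simp: disk_algebra_def)
  have "(h \<longlongrightarrow> h \<zeta>) (at \<zeta> within cball 0 1)"
    using h(2) assms(2) by (auto simp: continuous_on_def)
  then have "(h \<longlongrightarrow> h \<zeta>) (at \<zeta> within unit_disk)" by (rule tendsto_within_subset) auto
  then have "(k \<longlongrightarrow> h \<zeta>) (at \<zeta> within unit_disk)"
    by (rule Lim_transform_eventually)
       (use eventually_in_disk[of \<zeta>] in eventually_elim, simp add: h on_disk_def)
  then show ?thesis by blast
qed

text \<open>Limits at the individual boundary points already assemble to a continuous extension,
  because the target space is regular.\<close>

lemma disk_algebraI:
  assumes hol: "k holomorphic_on unit_disk"
    and lim: "\<And>\<zeta>. \<zeta> \<in> unit_circle \<Longrightarrow> \<exists>l. (k \<longlongrightarrow> l) (at \<zeta> within unit_disk)"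
  shows "on_disk k \<in> disk_algebra"
proof -
  have ext: "\<exists>l. limitin euclidean k l (atin_within euclidean t unit_disk)" if "t \<in> cball 0 1 - unit_disk" for t
  proof -
    have "t \<in> unit_circle" using that by auto
    moreover have "atin_within euclidean t unit_disk = at t within unit_disk"
      by (simp add: atin_within_def at_within_def nhdsin_def nhds_def)
    ultimately show ?thesis using lim by simp
  qed
  obtain g where g: "continuous_map (subtopology euclidean (cball 0 1)) euclidean g"
      "\<And>x. x \<in> unit_disk \<Longrightarrow> g x = k x"
  proof (rule continuous_map_extension_pointwise_alt[of euclidean unit_disk "cball 0 1" euclidean k])
    show "regular_space (euclidean :: complex topology)" by (simp add: regular_space_euclidean)
    show "continuous_map (top_of_set unit_disk) euclidean k"
      using hol by (simp add: holomorphic_on_imp_continuous_on)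
  qed (use ext in auto)
  have "g holomorphic_on unit_disk" using hol by (rule holomorphic_transform) (simp add: g)
  moreover have "continuous_on (cball 0 1) g" using g(1) by simp
  moreover have "on_disk k = on_disk g" by (rule on_disk_eqI) (simp add: g)
  ultimately show ?thesis unfolding disk_algebra_def by blast
qed

lemma disk_algebra_entire:
  assumes "h holomorphic_on UNIV"
  shows "on_disk h \<in> disk_algebra"
proof -
  have "continuous_on (cball 0 1) h" "h holomorphic_on unit_disk"
    using assms holomorphic_on_imp_continuous_on holomorphic_on_subset continuous_on_subset
    by (metis subset_UNIV)+
  then show ?thesis unfolding disk_algebra_def by blast
qed

lemma uniform_closure_iff:
  "h \<in> uniform_closure B \<longleftrightarrow> h \<in> Hinf \<and> (\<forall>e>0. \<exists>k\<in>B. \<forall>z\<in>unit_disk. norm (h z - k z) < e)"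
proof
  assume "h \<in> uniform_closure B"
  then obtain k where h: "h \<in> Hinf" and k: "\<And>n. k n \<in> B" and u: "uniform_limit unit_disk k h sequentially"
    by (auto simp: uniform_closure_def)
  have "\<exists>k\<in>B. \<forall>z\<in>unit_disk. norm (h z - k z) < e" if "e > 0" for e
  proof -
    have "\<forall>\<^sub>F n in sequentially. \<forall>z\<in>unit_disk. dist (k n z) (h z) < e"
      by (rule uniform_limitD[OF u \<open>e > 0\<close>])
    then obtain n where "\<forall>z\<in>unit_disk. dist (k n z) (h z) < e"
      by (auto simp: eventually_sequentially)
    then have "\<forall>z\<in>unit_disk. norm (h z - k n z) < e" by (simp add: dist_norm norm_minus_commute)
    then show ?thesis using k[of n] by blast
  qed
  with h show "h \<in> Hinf \<and> (\<forall>e>0. \<exists>k\<in>B. \<forall>z\<in>unit_disk. norm (h z - k z) < e)" by blast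
next
  assume h: "h \<in> Hinf \<and> (\<forall>e>0. \<exists>k\<in>B. \<forall>z\<in>unit_disk. norm (h z - k z) < e)"
  have "\<forall>n::nat. \<exists>k\<in>B. \<forall>z\<in>unit_disk. norm (h z - k z) < inverse (real (Suc n))"
    using h by (auto intro: inverse_positive_iff_positive)
  then obtain k where k: "\<And>n. k n \<in> B" "\<And>n z. z \<in> unit_disk \<Longrightarrow> norm (h z - k n z) < inverse (real (Suc n))"
    by metis
  have "uniform_limit unit_disk k h sequentially"
  proof (rule uniform_limitI)
    fix e :: real assume "e > 0"
    then have "\<forall>\<^sub>F n in sequentially. inverse (real (Suc n)) < e"
      using LIMSEQ_inverse_real_of_nat order_tendstoD(2) by blast
    then show "\<forall>\<^sub>F n in sequentially. \<forall>z\<in>unit_disk. dist (k n z) (h z) < e"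
      by eventually_elim (metis k(2) dist_norm norm_minus_commute less_trans)
  qed
  then show "h \<in> uniform_closure B" using h k(1) by (auto simp: uniform_closure_def)
qed

section \<open>Uniformly closed algebras containing the disk algebra\<close>

locale disk_function_algebra =
  fixes G :: "(complex \<Rightarrow> complex) set"
  assumes disk_algebra_sub: "disk_algebra \<subseteq> G" and gens_Hinf: "G \<subseteq> Hinf"
begin

definition alg :: "(complex \<Rightarrow> complex) set" where
  "alg = uniform_closure (generated_algebra G)"

lemma alg_Hinf: "h \<in> alg \<Longrightarrow> h \<in> Hinf"
  by (simp add: alg_def uniform_closure_def)

lemma generated_Hinf: "h \<in> generated_algebra G \<Longrightarrow> h \<in> Hinf"
  by (induction rule: generated_algebra.induct)
     (use gens_Hinf in \<open>auto intro: Hinf_add Hinf_scale Hinf_mult\<close>)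

lemma generated_alg: "h \<in> generated_algebra G \<Longrightarrow> h \<in> alg"
  unfolding alg_def uniform_closure_iff using generated_Hinf by (auto intro!: bexI[of _ h])

lemma gens_alg: "h \<in> G \<Longrightarrow> h \<in> alg"
  by (intro generated_alg generated_algebra.gen)

lemma disk_algebra_alg: "h \<in> disk_algebra \<Longrightarrow> h \<in> alg"
  using disk_algebra_sub gens_alg by blast

lemma alg_approx:
  assumes "h \<in> alg" "e > 0"
  obtains k where "k \<in> generated_algebra G" "\<And>z. z \<in> unit_disk \<Longrightarrow> norm (h z - k z) < e"
  using assms unfolding alg_def uniform_closure_iff by blast

text \<open>Closing twice under uniform limits adds nothing: the approximants may be taken from the
  closed algebra itself, at the cost of half the tolerance.\<close>

lemma algI:
  assumes "h \<in> Hinf" "\<And>e. e > 0 \<Longrightarrow> \<exists>k\<in>alg. \<forall>z\<in>unit_disk. norm (h z - k z) \<le> e"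
  shows "h \<in> alg"
  unfolding alg_def uniform_closure_iff
proof (intro conjI assms(1) allI impI)
  fix e :: real assume "e > 0"
  then obtain k where k: "k \<in> alg" "\<And>z. z \<in> unit_disk \<Longrightarrow> norm (h z - k z) \<le> e/2"
    using assms(2)[of "e/2"] by auto
  obtain l where l: "l \<in> generated_algebra G" "\<And>z. z \<in> unit_disk \<Longrightarrow> norm (k z - l z) < e/2"
    using alg_approx[OF k(1), of "e/2"] \<open>e > 0\<close> by auto
  have "norm (h z - l z) < e" if "z \<in> unit_disk" for z
    using norm_triangle_ineq[of "h z - k z" "k z - l z"] k(2)[OF that] l(2)[OF that] by simp
  then show "\<exists>k\<in>generated_algebra G. \<forall>z\<in>unit_disk. norm (h z - k z) < e" using l(1) by blast
qed

lemma alg_add: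
  assumes "h \<in> alg" "k \<in> alg"
  shows "(\<lambda>z. h z + k z) \<in> alg"
proof (rule algI)
  show "(\<lambda>z. h z + k z) \<in> Hinf" using assms by (intro Hinf_add alg_Hinf)
  fix e :: real assume "e > 0"
  then have e: "e/2 > 0" by simp
  obtain h' where h': "h' \<in> generated_algebra G" "\<And>z. z \<in> unit_disk \<Longrightarrow> norm (h z - h' z) < e/2"
    by (rule alg_approx[OF assms(1) e]) blast
  obtain k' where k': "k' \<in> generated_algebra G" "\<And>z. z \<in> unit_disk \<Longrightarrow> norm (k z - k' z) < e/2"
    by (rule alg_approx[OF assms(2) e]) blast
  have "norm (h z + k z - (h' z + k' z)) \<le> e" if "z \<in> unit_disk" for z
    using norm_triangle_ineq[of "h z - h' z" "k z - k' z"] h'(2)[OF that] k'(2)[OF that]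
    by (simp add: algebra_simps)
  then show "\<exists>l\<in>alg. \<forall>z\<in>unit_disk. norm (h z + k z - l z) \<le> e"
    by (intro bexI[of _ "\<lambda>z. h' z + k' z"] generated_alg generated_algebra.add h' k') auto
qed

lemma alg_mult:
  assumes "h \<in> alg" "k \<in> alg"
  shows "(\<lambda>z. h z * k z) \<in> alg"
proof (rule algI)
  show "(\<lambda>z. h z * k z) \<in> Hinf" using assms by (intro Hinf_mult alg_Hinf)
  fix e :: real assume "e > 0"
  obtain M where M: "M > 0" "\<And>z. norm (h z) \<le> M" by (rule HinfE[OF alg_Hinf[OF assms(1)]]) blast
  \<comment> \<open>The choices are ordered: \<open>k'\<close> is taken close to \<open>k\<close>
    relative to the bound of \<open>h\<close>, and only then \<open>h'\<close> close to
    \<open>h\<close> relative to the bound of \<open>k'\<close>.\<close>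
  obtain k' where k': "k' \<in> generated_algebra G" "\<And>z. z \<in> unit_disk \<Longrightarrow> norm (k z - k' z) < e/(2*M)"
    by (rule alg_approx[OF assms(2), of "e/(2*M)"]) (use M \<open>e > 0\<close> in auto)
  obtain N where N: "N > 0" "\<And>z. norm (k' z) \<le> N" by (rule HinfE[OF generated_Hinf[OF k'(1)]]) blast
  obtain h' where h': "h' \<in> generated_algebra G" "\<And>z. z \<in> unit_disk \<Longrightarrow> norm (h z - h' z) < e/(2*N)"
    by (rule alg_approx[OF assms(1), of "e/(2*N)"]) (use N \<open>e > 0\<close> in auto)
  have "norm (h z * k z - h' z * k' z) \<le> e" if "z \<in> unit_disk" for z
  proof -
    have "norm (h z * k z - h' z * k' z) = norm (h z * (k z - k' z) + (h z - h' z) * k' z)"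
      by (simp add: algebra_simps)
    also have "\<dots> \<le> norm (h z) * norm (k z - k' z) + norm (h z - h' z) * norm (k' z)"
      by (metis norm_mult norm_triangle_ineq)
    also have "\<dots> \<le> M * (e/(2*M)) + (e/(2*N)) * N"
      by (intro add_mono mult_mono) (use M N h'(2)[OF that] k'(2)[OF that] \<open>e > 0\<close> in auto)
    also have "\<dots> = e" using M N by simp
    finally show ?thesis .
  qed
  then show "\<exists>l\<in>alg. \<forall>z\<in>unit_disk. norm (h z * k z - l z) \<le> e"
    by (intro bexI[of _ "\<lambda>z. h' z * k' z"] generated_alg generated_algebra.mult h' k') auto
qed

lemma alg_const: "on_disk (\<lambda>_. c) \<in> alg"
  by (intro disk_algebra_alg disk_algebra_entire holomorphic_intros)

lemma alg_scale:
  assumes "h \<in> alg"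
  shows "(\<lambda>z. c * h z) \<in> alg"
proof -
  \<comment> \<open>Elements of the algebra vanish off the disk, so a constant cut off there
    multiplies them like the true constant.\<close>
  have "(\<lambda>z. on_disk (\<lambda>_. c) z * h z) = (\<lambda>z. c * h z)"
    using alg_Hinf[OF assms] by (auto simp: on_disk_def Hinf_def fun_eq_iff)
  with alg_mult[OF alg_const assms, of c] show ?thesis by simp
qed

lemma alg_diff:
  assumes "h \<in> alg" "k \<in> alg"
  shows "(\<lambda>z. h z - k z) \<in> alg"
  using alg_add[OF assms(1) alg_scale[OF assms(2), of "-1"]] by simp

text \<open>The Neumann series, through its partial sums \<open>p\<^sub>0 = 0\<close>, \<open>p\<^sub>n\<^sub>+\<^sub>1 = 1 + q p\<^sub>n\<close>.\<close>

lemma alg_inverse_one_minus: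
  assumes q: "q \<in> alg" and \<rho>: "\<rho> < 1" "\<And>z. z \<in> unit_disk \<Longrightarrow> norm (q z) \<le> \<rho>"
  shows "on_disk (\<lambda>z. 1 / (1 - q z)) \<in> alg"
proof (rule algI)
  define v where "v = on_disk (\<lambda>z. 1 / (1 - q z))"
  have n: "1 - \<rho> \<le> norm (1 - q z)" if "z \<in> unit_disk" for z
    using norm_triangle_ineq2[of 1 "q z"] \<rho>(2)[OF that] by simp
  have nz: "1 - q z \<noteq> 0" if "z \<in> unit_disk" for z
    using n[OF that] \<rho>(1) by auto
  have vb: "norm (v z) \<le> 1 / (1 - \<rho>)" if "z \<in> unit_disk" for z
    unfolding v_def on_disk_def using that n[OF that] \<rho>(1) nz[OF that]
    by (simp add: norm_divide frac_le)
  have rho0: "0 \<le> \<rho>" using order_trans[OF norm_ge_zero \<rho>(2)[of 0]] by simp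
  have "q holomorphic_on unit_disk" using alg_Hinf[OF q] by (simp add: Hinf_def)
  then have "(\<lambda>z. 1 / (1 - q z)) holomorphic_on unit_disk"
    using nz by (intro holomorphic_intros) auto
  moreover have "norm (1 / (1 - q z)) \<le> 1 / (1 - \<rho>)" if "z \<in> unit_disk" for z
    using vb[OF that] that by (simp add: v_def on_disk_def)
  ultimately show "on_disk (\<lambda>z. 1 / (1 - q z)) \<in> Hinf" by (rule HinfI)
  have approx: "\<exists>p\<in>alg. \<forall>z\<in>unit_disk. norm (v z - p z) \<le> \<rho> ^ n * (1 / (1 - \<rho>))" for n
  proof (induction n)
    case 0
    then show ?case using vb by (intro bexI[of _ "on_disk (\<lambda>_. 0)"] alg_const) (auto simp: on_disk_def)
  next
    case (Suc n)
    then obtain p where p: "p \<in> alg" "\<And>z. z \<in> unit_disk \<Longrightarrow> norm (v z - p z) \<le> \<rho> ^ n * (1 / (1 - \<rho>))"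
      by auto
    let ?p = "\<lambda>z. on_disk (\<lambda>_. 1) z + q z * p z"
    have "norm (v z - ?p z) \<le> \<rho> ^ Suc n * (1 / (1 - \<rho>))" if z: "z \<in> unit_disk" for z
    proof -
      \<comment> \<open>The inverse satisfies v = 1 + q v, so each step multiplies the error by
        \<open>q\<close>.\<close>
      have "v z - ?p z = q z * (v z - p z)"
        using z nz[OF z] by (simp add: v_def on_disk_def field_simps)
      then have "norm (v z - ?p z) = norm (q z) * norm (v z - p z)" by (simp add: norm_mult)
      also have "\<dots> \<le> \<rho> * (\<rho> ^ n * (1 / (1 - \<rho>)))"
        using \<rho>(2)[OF z] p(2)[OF z] rho0 by (intro mult_mono) auto
      finally show ?thesis by (simp add: mult.assoc)
    qed
    moreover have "?p \<in> alg" by (rule alg_add[OF alg_const alg_mult[OF q p(1)]])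
    ultimately show ?case by (intro bexI[of _ ?p] ballI)
  qed
  fix e :: real assume "e > 0"
  have "(\<lambda>n. \<rho> ^ n * (1 / (1 - \<rho>))) \<longlonglongrightarrow> 0"
    using rho0 \<rho>(1) by (intro tendsto_mult_left_zero LIMSEQ_realpow_zero) auto
  then have "\<forall>\<^sub>F n in sequentially. \<rho> ^ n * (1 / (1 - \<rho>)) < e"
    using order_tendstoD(2) \<open>e > 0\<close> by blast
  then obtain n where "\<rho> ^ n * (1 / (1 - \<rho>)) < e" by (auto simp: eventually_sequentially)
  with approx[of n] show "\<exists>p\<in>alg. \<forall>z\<in>unit_disk. norm (on_disk (\<lambda>z. 1 / (1 - q z)) z - p z) \<le> e"
    unfolding v_def[symmetric] by (meson less_imp_le order_trans)
qed

lemma point_eval_in_max_ideal_space: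
  assumes "z \<in> unit_disk"
  shows "point_eval alg z \<in> max_ideal_space alg"
proof -
  have "\<exists>f\<in>alg. point_eval alg z f \<noteq> 0"
    by (rule bexI[OF _ alg_const[of 1]])
       (use assms alg_const[of 1] in \<open>simp add: point_eval_def on_disk_def\<close>)
  then show ?thesis
    unfolding max_ideal_space_def by (auto simp: point_eval_def alg_add alg_mult alg_scale)
qed

end

section \<open>Characters\<close>

locale disk_character = disk_function_algebra +
  fixes \<phi> :: "(complex \<Rightarrow> complex) \<Rightarrow> complex"
  assumes char: "\<phi> \<in> max_ideal_space alg"
begin

lemma phi_add: "h \<in> alg \<Longrightarrow> k \<in> alg \<Longrightarrow> \<phi> (\<lambda>z. h z + k z) = \<phi> h + \<phi> k"
  using char by (simp add: max_ideal_space_def)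

lemma phi_mult: "h \<in> alg \<Longrightarrow> k \<in> alg \<Longrightarrow> \<phi> (\<lambda>z. h z * k z) = \<phi> h * \<phi> k"
  using char by (simp add: max_ideal_space_def)

lemma phi_scale: "h \<in> alg \<Longrightarrow> \<phi> (\<lambda>z. c * h z) = c * \<phi> h"
  using char by (simp add: max_ideal_space_def)

lemma phi_diff: "h \<in> alg \<Longrightarrow> k \<in> alg \<Longrightarrow> \<phi> (\<lambda>z. h z - k z) = \<phi> h - \<phi> k"
  using phi_add[of h "\<lambda>z. -1 * k z"] phi_scale[of k "-1"] alg_scale[of k "-1"] by simp

text \<open>The cut-off constant 1 is the unit of the algebra; applying the character to 1 f = f for
  some \<open>f\<close> with nonzero value gives the claim.\<close>

lemma phi_one: "\<phi> (on_disk (\<lambda>_. 1)) = 1"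
proof -
  obtain f where f: "f \<in> alg" "\<phi> f \<noteq> 0" using char by (auto simp: max_ideal_space_def)
  have "(\<lambda>z. on_disk (\<lambda>_. 1) z * f z) = f"
    using alg_Hinf[OF f(1)] by (auto simp: on_disk_def Hinf_def fun_eq_iff)
  with phi_mult[OF alg_const f(1), of 1] f(2) show ?thesis by simp
qed

lemma phi_const: "\<phi> (on_disk (\<lambda>_. c)) = c"
proof -
  have "(\<lambda>z. c * on_disk (\<lambda>_. 1) z) = on_disk (\<lambda>_. c)" by (auto simp: on_disk_def)
  with phi_scale[OF alg_const, of c 1] phi_one show ?thesis by simp
qed

text \<open>If the value exceeded the bound, \<open>q\<close>, the quotient of \<open>h\<close> by
  that value, would have supremum below 1. Then 1 - q would be invertible in the algebra, although
  the character maps it to 0.\<close>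

lemma phi_norm_le:
  assumes h: "h \<in> alg" and M: "\<And>z. z \<in> unit_disk \<Longrightarrow> norm (h z) \<le> M"
  shows "norm (\<phi> h) \<le> M"
proof (rule ccontr)
  assume "\<not> norm (\<phi> h) \<le> M"
  then have gt: "M < norm (\<phi> h)" by simp
  have M0: "0 \<le> M" using order_trans[OF norm_ge_zero M[of 0]] by simp
  define q where "q = (\<lambda>z. inverse (\<phi> h) * h z)"
  have q: "q \<in> alg" unfolding q_def by (rule alg_scale[OF h])
  have nz: "\<phi> h \<noteq> 0" using gt M0 by auto
  have phiq: "\<phi> q = 1" unfolding q_def phi_scale[OF h] using nz by simp
  have \<rho>: "M / norm (\<phi> h) < 1" using gt nz by (simp add: divide_less_eq)
  have qb: "norm (q z) \<le> M / norm (\<phi> h)" if "z \<in> unit_disk" for z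
    using mult_right_mono[OF M[OF that], of "inverse (norm (\<phi> h))"]
    by (simp add: q_def norm_mult norm_inverse divide_inverse mult.commute)
  define v where "v = on_disk (\<lambda>z. 1 / (1 - q z))"
  have v: "v \<in> alg" unfolding v_def by (rule alg_inverse_one_minus[OF q \<rho> qb])
  have "q z \<noteq> 1" if "z \<in> unit_disk" for z
    using qb[OF that] \<rho> by auto
  then have "(\<lambda>z. (on_disk (\<lambda>_. 1) z - q z) * v z) = on_disk (\<lambda>_. 1)"
    by (auto simp: v_def on_disk_def fun_eq_iff)
  then have "\<phi> (on_disk (\<lambda>_. 1)) = (\<phi> (on_disk (\<lambda>_. 1)) - \<phi> q) * \<phi> v"
    using phi_mult[OF alg_diff[OF alg_const q] v, of 1] phi_diff[OF alg_const q, of 1] by simp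
  then show False using phi_one phiq by simp
qed

text \<open>The value on the coordinate function tells over which point of the closed disk the
  character lies. Interior and boundary points are treated by different arguments.\<close>

definition base_point :: complex where
  "base_point = \<phi> (on_disk (\<lambda>z. z))"

lemma alg_id: "on_disk (\<lambda>z. z) \<in> alg"
  by (intro disk_algebra_alg disk_algebra_entire holomorphic_intros)

lemma norm_base_point_le: "norm base_point \<le> 1"
  unfolding base_point_def by (rule phi_norm_le[OF alg_id]) (simp add: on_disk_def)

text \<open>Multiplying by high powers of the peaking function \<open>(1 + cnj \<zeta> z) / 2\<close> at the base point
  \<open>\<zeta>\<close> does not change the value of the character, but kills \<open>h\<close> away from \<open>\<zeta>\<close>.\<close>

lemma phi_norm_le_local:
  assumes bp: "norm base_point = 1" and h: "h \<in> alg"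
    and ev: "eventually (\<lambda>z. norm (h z) \<le> M) (at base_point within unit_disk)"
  shows "norm (\<phi> h) \<le> M"
proof -
  let ?\<zeta> = base_point
  have M0: "0 \<le> M"
  proof -
    obtain z where "norm (h z) \<le> M"
      using eventually_happens[OF ev] at_within_unit_disk_neq_bot[of ?\<zeta>] bp by auto
    then show ?thesis using norm_ge_zero order_trans by blast
  qed
  obtain \<delta> where \<delta>: "\<delta> > 0" "\<And>z. z \<in> unit_disk \<Longrightarrow> z \<noteq> ?\<zeta> \<Longrightarrow> dist z ?\<zeta> < \<delta> \<Longrightarrow> norm (h z) \<le> M"
    using ev unfolding eventually_at by auto
  obtain N where N: "N > 0" "\<And>z. norm (h z) \<le> N" by (rule HinfE[OF alg_Hinf[OF h]]) blast
  define p where "p = (\<lambda>z. (1/2) * (on_disk (\<lambda>_. 1) z + cnj ?\<zeta> * on_disk (\<lambda>z. z) z))"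
  have p: "p \<in> alg" unfolding p_def by (intro alg_scale alg_add alg_const alg_id)
  have "\<phi> p = (1/2) * (1 + cnj ?\<zeta> * ?\<zeta>)"
    unfolding p_def phi_scale[OF alg_add[OF alg_const alg_scale[OF alg_id]]]
      phi_add[OF alg_const alg_scale[OF alg_id]] phi_scale[OF alg_id] phi_one
    by (simp add: base_point_def)
  also have "cnj ?\<zeta> * ?\<zeta> = 1" using bp by (metis complex_norm_square mult.commute of_real_1 power_one)
  finally have phip: "\<phi> p = 1" by simp
  \<comment> \<open>The parallelogram identity for 1 and \<open>w = cnj \<zeta> * z\<close>: the
    squares of the norms of 1 + w and w - 1 add up to at most 4.\<close>
  have pz: "norm (p z) ^ 2 \<le> 1 - (dist z ?\<zeta> / 2)\<^sup>2" if z: "z \<in> unit_disk" for z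
  proof -
    define w where "w = cnj ?\<zeta> * z"
    have "norm w \<le> 1" using z bp by (simp add: w_def norm_mult)
    then have "(norm w)\<^sup>2 \<le> 1" by (simp add: power_le_one)
    moreover have "norm (1 + w) ^ 2 + norm (w - 1) ^ 2 = 2 + 2 * norm w ^ 2"
      unfolding cmod_power2 by (simp add: power2_eq_square algebra_simps)
    moreover have "norm (w - 1) = dist z ?\<zeta>"
    proof -
      have "w - 1 = cnj ?\<zeta> * (z - ?\<zeta>)"
        using \<open>cnj ?\<zeta> * ?\<zeta> = 1\<close> by (simp add: w_def algebra_simps)
      then show ?thesis using bp by (simp add: norm_mult dist_norm)
    qed
    moreover have "norm (p z) = norm (1 + w) / 2"
      using z by (simp add: p_def w_def on_disk_def norm_divide norm_mult)
    ultimately show ?thesis by (simp only: power_divide) simp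
  qed
  \<comment> \<open>The maximum with 0 covers the case of a radius \<open>\<delta>\<close> larger
    than 2, where the radicand would be negative.\<close>
  define \<rho> where "\<rho> = sqrt (max 0 (1 - (\<delta> / 2)\<^sup>2))"
  have \<rho>: "0 \<le> \<rho>" "\<rho> < 1" using \<delta>(1) by (auto simp: \<rho>_def)
  have p1: "norm (p z) \<le> 1" if "z \<in> unit_disk" for z
  proof -
    have "norm (p z) ^ 2 \<le> 1\<^sup>2" unfolding one_power2 using pz[OF that] zero_le_power2[of "dist z ?\<zeta> / 2"] by linarith
    then show ?thesis by (rule power2_le_imp_le) simp
  qed
  have p\<rho>: "norm (p z) \<le> \<rho>" if "z \<in> unit_disk" "dist z ?\<zeta> \<ge> \<delta>" for z
  proof -
    have "(\<delta>/2)\<^sup>2 \<le> (dist z ?\<zeta> / 2)\<^sup>2" using that \<delta>(1) by (intro power_mono) auto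
    then have "norm (p z) ^ 2 \<le> 1 - (\<delta> / 2)\<^sup>2" using pz[OF that(1)] by linarith
    then have "norm (p z) ^ 2 \<le> max 0 (1 - (\<delta> / 2)\<^sup>2)" by simp
    then have "sqrt (norm (p z) ^ 2) \<le> \<rho>" unfolding \<rho>_def by (rule real_sqrt_le_mono)
    then show ?thesis by simp
  qed
  have pow: "(\<lambda>z. p z ^ n * h z) \<in> alg \<and> \<phi> (\<lambda>z. p z ^ n * h z) = \<phi> h" for n
  proof (induction n)
    case (Suc n)
    have "(\<lambda>z. p z ^ Suc n * h z) = (\<lambda>z. p z * (p z ^ n * h z))" by (simp add: mult.assoc)
    with Suc show ?case using alg_mult[OF p] phi_mult[OF p] phip by simp
  qed (simp add: h)
  \<comment> \<open>Near the base point the product is bounded by \<open>M\<close>, elsewhere by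
    \<open>\<rho> ^ n * N\<close>; the second bound disappears as \<open>n\<close> grows.\<close>
  have "norm (\<phi> h) \<le> M + \<rho> ^ n * N" for n
  proof -
    have "norm (p z ^ n * h z) \<le> M + \<rho> ^ n * N" if z: "z \<in> unit_disk" for z
    proof (cases "dist z ?\<zeta> < \<delta>")
      case True
      have "z \<noteq> ?\<zeta>" using z bp by auto
      then have "norm (p z ^ n) * norm (h z) \<le> 1 * M"
        using \<delta>(2)[OF z _ True] p1[OF z] M0 by (intro mult_mono) (auto simp: norm_power power_le_one)
      moreover have "0 \<le> \<rho> ^ n * N" using \<rho> N by simp
      ultimately show ?thesis by (simp add: norm_mult)
    next
      case False
      then have "norm (p z ^ n) * norm (h z) \<le> \<rho> ^ n * N"
        using p\<rho>[OF z] N \<rho> by (intro mult_mono) (auto simp: norm_power power_mono)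
      then show ?thesis using M0 by (simp add: norm_mult)
    qed
    then show ?thesis using phi_norm_le[of "\<lambda>z. p z ^ n * h z"] pow[of n] by simp
  qed
  moreover have "(\<lambda>n. M + \<rho> ^ n * N) \<longlonglongrightarrow> M + 0 * N"
    using \<rho> by (intro tendsto_intros LIMSEQ_realpow_zero) auto
  ultimately show ?thesis
    by (intro LIMSEQ_le_const[of "\<lambda>n. M + \<rho> ^ n * N"]) auto
qed

text \<open>The local bound is applied to \<open>h\<close> minus its limit, which is arbitrarily
  small near the base point.\<close>

lemma phi_eq_limit:
  assumes "norm base_point = 1" "h \<in> alg" "(h \<longlongrightarrow> l) (at base_point within unit_disk)"
  shows "\<phi> h = l"
proof -
  have "norm (\<phi> h - l) \<le> e" if "e > 0" for e
  proof -
    have "\<forall>\<^sub>F z in at base_point within unit_disk. dist (h z) l < e"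
      using assms(3) that by (rule tendstoD)
    then have "\<forall>\<^sub>F z in at base_point within unit_disk. norm (h z - on_disk (\<lambda>_. l) z) \<le> e"
      using eventually_in_disk by eventually_elim (simp add: on_disk_def dist_norm)
    then have "norm (\<phi> (\<lambda>z. h z - on_disk (\<lambda>_. l) z)) \<le> e"
      by (intro phi_norm_le_local assms alg_diff alg_const)
    then show ?thesis by (simp add: phi_diff assms alg_const phi_const)
  qed
  then have "norm (\<phi> h - l) \<le> 0" by (meson dense_ge)
  then show ?thesis by simp
qed

text \<open>The difference quotient of \<open>k\<close> at the base point again lies in the disk
  algebra. Hence k minus its value there is a product with the factor z minus the base point, which
  the character maps to 0.\<close>

lemma phi_interior_aux:
  assumes bp: "norm base_point < 1" and hol: "k holomorphic_on unit_disk"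
    and lim: "\<And>\<zeta>. \<zeta> \<in> unit_circle \<Longrightarrow> \<exists>l. (k \<longlongrightarrow> l) (at \<zeta> within unit_disk)"
  shows "\<phi> (on_disk k) = k base_point"
proof -
  let ?a = base_point
  define q where "q = (\<lambda>z. if z = ?a then deriv k ?a else (k z - k ?a) / (z - ?a))"
  have "q holomorphic_on unit_disk" unfolding q_def by (rule pole_lemma_open[OF hol]) simp
  moreover have "\<exists>l. (q \<longlongrightarrow> l) (at \<zeta> within unit_disk)" if "\<zeta> \<in> unit_circle" for \<zeta>
  proof -
    obtain l where "(k \<longlongrightarrow> l) (at \<zeta> within unit_disk)" using lim \<open>\<zeta> \<in> unit_circle\<close> by blast
    moreover have ne: "\<zeta> \<noteq> ?a" using that bp by auto
    ultimately have "((\<lambda>z. (k z - k ?a) / (z - ?a)) \<longlongrightarrow> (l - k ?a) / (\<zeta> - ?a)) (at \<zeta> within unit_disk)"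
      by (intro tendsto_intros) auto
    moreover have "\<forall>\<^sub>F z in at \<zeta> within unit_disk. (k z - k ?a) / (z - ?a) = q z"
    proof -
      have "\<forall>\<^sub>F z in at \<zeta> within unit_disk. z \<noteq> ?a"
        using ne by (rule tendsto_imp_eventually_ne[OF tendsto_ident_at])
      then show ?thesis by eventually_elim (simp add: q_def)
    qed
    ultimately show ?thesis using Lim_transform_eventually by blast
  qed
  ultimately have q: "on_disk q \<in> alg" by (intro disk_algebra_alg disk_algebraI)
  have "on_disk k = (\<lambda>z. on_disk q z * (on_disk (\<lambda>z. z) z - on_disk (\<lambda>_. ?a) z) + on_disk (\<lambda>_. k ?a) z)"
    by (auto simp: on_disk_def q_def fun_eq_iff)
  then have "\<phi> (on_disk k) = \<phi> (on_disk q) * (?a - ?a) + k ?a"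
    by (simp add: phi_add phi_mult phi_diff q alg_id alg_const alg_mult alg_diff phi_const flip: base_point_def)
  then show ?thesis by simp
qed

text \<open>A polynomial \<open>P\<close> with zeros at the exceptional points removes the
  discontinuities of the bounded function \<open>k\<close>. It can be cancelled afterwards, since
  its zeros lie on the circle and the base point does not.\<close>

lemma phi_interior:
  assumes bp: "norm base_point < 1" and k: "k \<in> alg" and F: "finite F" "F \<subseteq> unit_circle"
    and lim: "\<And>\<zeta>. \<zeta> \<in> unit_circle - F \<Longrightarrow> \<exists>l. (k \<longlongrightarrow> l) (at \<zeta> within unit_disk)"
  shows "\<phi> k = k base_point"
proof -
  define P where "P = (\<lambda>z. \<Prod>s\<in>F. z - s)"
  have Phol: "P holomorphic_on X" for X unfolding P_def by (intro holomorphic_intros)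
  have Plim: "(P \<longlongrightarrow> P \<zeta>) (at \<zeta> within unit_disk)" for \<zeta>
    unfolding P_def by (intro tendsto_intros)
  have P: "on_disk P \<in> alg" by (intro disk_algebra_alg disk_algebra_entire Phol)
  have phiP: "\<phi> (on_disk P) = P base_point"
    using Plim by (intro phi_interior_aux bp Phol) blast
  have khol: "k holomorphic_on unit_disk" using alg_Hinf[OF k] by (simp add: Hinf_def)
  have "\<phi> (on_disk (\<lambda>z. k z * P z)) = k base_point * P base_point"
  proof (rule phi_interior_aux[OF bp])
    show "(\<lambda>z. k z * P z) holomorphic_on unit_disk" by (intro holomorphic_intros khol Phol)
    fix \<zeta> :: complex assume \<zeta>: "\<zeta> \<in> unit_circle"
    show "\<exists>l. ((\<lambda>z. k z * P z) \<longlongrightarrow> l) (at \<zeta> within unit_disk)"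
    proof (cases "\<zeta> \<in> F")
      case True
      then have "P \<zeta> = 0" using F by (auto simp: P_def)
      then have P0: "(P \<longlongrightarrow> 0) (at \<zeta> within unit_disk)" using Plim[of \<zeta>] by simp
      obtain N where N: "\<And>z. norm (k z) \<le> N" using HinfE[OF alg_Hinf[OF k]] by blast
      have "((\<lambda>z. k z * P z) \<longlongrightarrow> 0) (at \<zeta> within unit_disk)"
      proof (rule Lim_null_comparison)
        show "\<forall>\<^sub>F z in at \<zeta> within unit_disk. norm (k z * P z) \<le> N * norm (P z)"
          using N by (simp add: norm_mult mult_right_mono)
        show "((\<lambda>z. N * norm (P z)) \<longlongrightarrow> 0) (at \<zeta> within unit_disk)"
          using P0 by (intro tendsto_mult_right_zero tendsto_norm_zero)
      qed
      then show ?thesis by blast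
    next
      case False
      then obtain l where "(k \<longlongrightarrow> l) (at \<zeta> within unit_disk)" using lim \<zeta> by blast
      then show ?thesis using tendsto_mult[OF _ Plim[of \<zeta>]] by blast
    qed
  qed
  moreover have "on_disk (\<lambda>z. k z * P z) = (\<lambda>z. k z * on_disk P z)"
    by (auto simp: on_disk_def)
  ultimately have "\<phi> k * P base_point = k base_point * P base_point"
    using phi_mult[OF k P] phiP by simp
  moreover have "P base_point \<noteq> 0" using F bp by (auto simp: P_def)
  ultimately show ?thesis by simp
qed

end

section \<open>Simultaneous approximation of unitary characters of the reals\<close>

lemma norm_cis_minus_one_le: "norm (cis x - 1) \<le> \<bar>x\<bar>"
proof -
  have "norm (cis x - 1) = 2 * \<bar>sin (x / 2)\<bar>"
    using dist_exp_i_1[of x] by (simp add: cis_conv_exp)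
  also have "\<dots> \<le> 2 * \<bar>x / 2\<bar>" using abs_sin_x_le_abs_x[of "x / 2"] by linarith
  finally show ?thesis by simp
qed

text \<open>These are the characters of the discrete additive group of reals, that is, the points of
  its Bohr compactification; no continuity is demanded. The exponentials \<open>cis (x * t)\<close>
  are to be shown dense among them.\<close>

locale unitary_hom =
  fixes u :: "real \<Rightarrow> complex"
  assumes norm_u: "norm (u x) = 1" and hom: "u (x + y) = u x * u y"
begin

lemma u_0: "u 0 = 1"
proof -
  have "u 0 \<noteq> 0" using norm_u[of 0] by auto
  with hom[of 0 0] show ?thesis by simp
qed

lemma u_minus: "u (- x) = cnj (u x)"
proof -
  have "u x * u (- x) = 1" using hom[of x "-x"] u_0 by simp
  moreover have "u x * cnj (u x) = 1" using norm_u[of x] by (simp add: complex_norm_square[symmetric])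
  moreover have "u x \<noteq> 0" using norm_u[of x] by auto
  ultimately show ?thesis by (metis mult_left_cancel)
qed

text \<open>The frequencies at which the exponentials along the times \<open>t\<close> converge to
  \<open>u\<close>. They form an additive group, so integer combinations of frequencies come for
  free.\<close>

definition lim_set :: "(nat \<Rightarrow> real) \<Rightarrow> real set" where
  "lim_set t = {x. (\<lambda>j. cis (x * t j)) \<longlonglongrightarrow> u x}"

lemma lim_set_0: "0 \<in> lim_set t" by (simp add: lim_set_def u_0)

lemma lim_set_add: "x \<in> lim_set t \<Longrightarrow> y \<in> lim_set t \<Longrightarrow> x + y \<in> lim_set t"
  using tendsto_mult[of "\<lambda>j. cis (x * t j)" "u x" sequentially "\<lambda>j. cis (y * t j)" "u y"]
  by (simp add: lim_set_def hom cis_mult algebra_simps)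

lemma lim_set_minus: "x \<in> lim_set t \<Longrightarrow> - x \<in> lim_set t"
  using tendsto_cnj[of "\<lambda>j. cis (x * t j)" "u x" sequentially]
  by (simp add: lim_set_def u_minus cis_cnj)

lemma lim_set_int: 
  assumes "x \<in> lim_set t"
  shows "of_int m * x \<in> lim_set t"
proof -
  have nat: "of_nat n * x \<in> lim_set t" for n
    by (induction n) (use assms lim_set_0 in \<open>auto simp: algebra_simps intro: lim_set_add\<close>)
  show ?thesis
  proof (cases "m \<ge> 0")
    case True
    then show ?thesis using nat[of "nat m"] by simp
  next
    case False
    then show ?thesis using lim_set_minus[OF nat[of "nat (- m)"]] by simp
  qed
qed

lemma lim_set_sum: "finite A \<Longrightarrow> (\<And>x. x \<in> A \<Longrightarrow> f x \<in> lim_set t) \<Longrightarrow> sum f A \<in> lim_set t"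
  by (induction A rule: finite_induct) (auto intro: lim_set_0 lim_set_add)

text \<open>Kronecker's theorem, applied with the tolerances 1/(j+1), gives the \<open>j\<close>-th
  time.\<close>

lemma lim_set_independent:
  assumes "finite L" "module.independent (\<lambda>r. (*) (real_of_int r)) L"
  shows "\<exists>t. L \<subseteq> lim_set t"
proof -
  obtain \<theta> where \<theta>: "bij_betw \<theta> {..<card L} L"
    using ex_bij_betw_nat_finite[OF assms(1)] by (metis atLeast0LessThan)
  \<comment> \<open>The argument of \<open>u\<close> at each frequency, measured in full turns; the
    times are therefore rescaled by 2 pi below.\<close>
  define \<alpha> where "\<alpha> = (\<lambda>i. Arg (u (\<theta> i)) / (2 * pi))"
  have u\<alpha>: "u (\<theta> i) = cis (2 * pi * \<alpha> i)" for i
    using rcis_cmod_Arg[of "u (\<theta> i)"] norm_u[of "\<theta> i"] by (simp add: \<alpha>_def rcis_def)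
  have "\<exists>t h. \<forall>i<card L. \<bar>t * \<theta> i - of_int (h i) - \<alpha> i\<bar> < inverse (real (Suc j))" for j
  proof -
    have "inj_on \<theta> {..<card L}" "\<theta> ` {..<card L} = L" using \<theta> by (auto simp: bij_betw_def)
    then obtain t h where "\<And>i. i < card L \<Longrightarrow> \<bar>t * \<theta> i - of_int (h i) - \<alpha> i\<bar> < inverse (real (Suc j))"
      using Kronecker_thm_1[of \<theta> "card L" "inverse (real (Suc j))" \<alpha>] assms(2) by auto
    then show ?thesis by blast
  qed
  then obtain t h where th: "\<And>j i. i < card L \<Longrightarrow> \<bar>t j * \<theta> i - of_int (h j i) - \<alpha> i\<bar> < inverse (real (Suc j))"
    by metis
  have "L \<subseteq> lim_set (\<lambda>j. 2 * pi * t j)"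
  proof
    fix x assume "x \<in> L"
    then obtain i where i: "i < card L" "x = \<theta> i" using \<theta> by (auto simp: bij_betw_def)
    have "norm (cis (x * (2 * pi * t j)) - u x) \<le> 2 * pi * inverse (real (Suc j))" for j
    proof -
      define \<delta> where "\<delta> = t j * \<theta> i - of_int (h j i) - \<alpha> i"
      have "x * (2 * pi * t j) = (2 * pi * \<alpha> i + 2 * pi * \<delta>) + 2 * pi * of_int (h j i)"
        by (simp add: \<delta>_def i algebra_simps)
      then have "cis (x * (2 * pi * t j)) = cis (2 * pi * \<alpha> i) * cis (2 * pi * \<delta>)"
        by (simp only: cis_add_2pi_int cis_mult)
      then have "cis (x * (2 * pi * t j)) - u x = cis (2 * pi * \<alpha> i) * (cis (2 * pi * \<delta>) - 1)"
        by (simp add: i u\<alpha> algebra_simps)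
      then have "norm (cis (x * (2 * pi * t j)) - u x) = norm (cis (2 * pi * \<delta>) - 1)"
        by (simp add: norm_mult)
      also have "\<dots> \<le> \<bar>2 * pi * \<delta>\<bar>" by (rule norm_cis_minus_one_le)
      also have "\<dots> = 2 * pi * \<bar>\<delta>\<bar>" by (simp add: abs_mult)
      also have "\<dots> \<le> 2 * pi * inverse (real (Suc j))"
        using th[OF i(1), of j] by (intro mult_left_mono) (auto simp: \<delta>_def)
      finally show ?thesis .
    qed
    moreover have "(\<lambda>j. 2 * pi * inverse (real (Suc j))) \<longlonglongrightarrow> 0"
      by (intro tendsto_mult_right_zero LIMSEQ_inverse_real_of_nat)
    ultimately have "(\<lambda>j. cis (x * (2 * pi * t j)) - u x) \<longlonglongrightarrow> 0"
      by (rule Lim_null_comparison[OF always_eventually[OF allI]])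
    then show "x \<in> lim_set (\<lambda>j. 2 * pi * t j)"
      unfolding lim_set_def mem_Collect_eq by (rule Lim_null[THEN iffD2])
  qed
  then show ?thesis by blast
qed

text \<open>A rational relation between the frequencies is used to express one frequency as an integer
  combination of the others divided by a common denominator; \<open>u\<close> is defined on all reals, so the
  divided frequencies are covered by the induction hypothesis.\<close>

lemma lim_set_finite:
  assumes "finite L"
  shows "\<exists>t. L \<subseteq> lim_set t"
  using assms
proof (induction "card L" arbitrary: L rule: less_induct)
  case less
  \<comment> \<open>The reals as a module over the integers, so that dependence means a nontrivial
    integer relation.\<close>
  interpret Modules.module "(\<lambda>r. (*) (real_of_int r))"
    by (simp add: Modules.module.intro distrib_left mult.commute)
  show ?case
  proof (cases "independent L")
    case True
    then show ?thesis using lim_set_independent less.prems by blast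
  next
    case False
    then obtain A m v0 where A: "finite A" "A \<subseteq> L" "(\<Sum>v\<in>A. of_int (m v) * v) = 0" "v0 \<in> A" "m v0 \<noteq> 0"
      unfolding dependent_explicit by blast
    let ?c = "real_of_int (m v0)"
    let ?L = "(\<lambda>x. x / ?c) ` (L - {v0})"
    have "card ?L \<le> card (L - {v0})" using less.prems by (intro card_image_le) auto
    also have "\<dots> < card L" using A less.prems by (intro card_Diff1_less) auto
    finally obtain t where t: "?L \<subseteq> lim_set t" using less by auto
    have other: "of_int k * (x / ?c) \<in> lim_set t" if "x \<in> L - {v0}" for x k
      using t that by (intro lim_set_int) auto
    have "v0 = (\<Sum>v\<in>A - {v0}. of_int (- m v) * (v / ?c))"
    proof -
      have "(\<Sum>v\<in>A. of_int (m v) * v) = ?c * v0 + (\<Sum>v\<in>A - {v0}. of_int (m v) * v)"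
        using A by (intro sum.remove) auto
      then have "?c * v0 = - (\<Sum>v\<in>A - {v0}. of_int (m v) * v)" using A by simp
      then have "v0 = - (\<Sum>v\<in>A - {v0}. of_int (m v) * v) / ?c" using A(5) by (simp add: field_simps)
      then show ?thesis by (simp add: sum_negf sum_divide_distrib)
    qed
    moreover have "(\<Sum>v\<in>A - {v0}. of_int (- m v) * (v / ?c)) \<in> lim_set t"
      using A by (intro lim_set_sum other) auto
    ultimately have "v0 \<in> lim_set t" by simp
    moreover have "x \<in> lim_set t" if "x \<in> L - {v0}" for x
      using other[OF that, of "m v0"] A(5) by simp
    ultimately show ?thesis by blast
  qed
qed

text \<open>The time obtained from the limit set need not be large. Dirichlet's theorem supplies a
  large common almost-period of the exponentials, and adding it hardly changes their values.\<close>

lemma simultaneous_approx: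
  assumes L: "finite L" and e: "e > 0"
  shows "\<exists>t\<ge>T. \<forall>x\<in>L. norm (cis (x * t) - u x) < e"
proof -
  obtain s where s: "L \<subseteq> lim_set s" using lim_set_finite[OF L] by blast
  have "\<forall>\<^sub>F j in sequentially. \<forall>x\<in>L. dist (cis (x * s j)) (u x) < e/2"
  proof (intro eventually_ball_finite ballI L)
    fix x assume "x \<in> L"
    then have "(\<lambda>j. cis (x * s j)) \<longlonglongrightarrow> u x" using s by (auto simp: lim_set_def)
    then show "\<forall>\<^sub>F j in sequentially. dist (cis (x * s j)) (u x) < e/2"
      by (rule tendstoD) (use e in simp)
  qed
  then obtain j where j: "\<forall>x\<in>L. dist (cis (x * s j)) (u x) < e/2"
    by (auto simp: eventually_sequentially)
  obtain N :: nat where N: "N > 0" "2 * pi / N < e/2"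
  proof -
    obtain N :: nat where "4 * pi / e < N" using reals_Archimedean2 by blast
    moreover have "0 < 4 * pi / e" using e by simp
    ultimately have "0 < real N" "4 * pi / e < N" by linarith+
    then have "N > 0" "4 * pi < e * N" using e by (auto simp: field_simps)
    then show ?thesis using that[of N] by (simp add: field_simps)
  qed
  \<comment> \<open>Chosen so that adding any positive integer multiple of \<open>R\<close> to
    \<open>s j\<close> gives a time beyond \<open>T\<close>.\<close>
  define R where "R = \<bar>T\<bar> + \<bar>s j\<bar> + 1"
  obtain \<theta> where \<theta>: "bij_betw \<theta> {..<card L} L"
    using ex_bij_betw_nat_finite[OF L] by (metis atLeast0LessThan)
  obtain q p where qp: "0 < q" "\<And>i. i < card L \<Longrightarrow> \<bar>of_int q * (\<theta> i * R / (2 * pi)) - of_int (p i)\<bar> < 1 / N"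
    by (rule Dirichlet_approx_simult[OF N(1), of "card L" "\<lambda>i. \<theta> i * R / (2 * pi)"]) (rule that)
  let ?t = "s j + of_int q * R"
  have "1 * R \<le> of_int q * R" using qp(1) by (intro mult_right_mono) (auto simp: R_def)
  then have "T \<le> ?t" by (simp add: R_def)
  moreover have "norm (cis (x * ?t) - u x) < e" if x: "x \<in> L" for x
  proof -
    obtain i where i: "i < card L" "x = \<theta> i" using \<theta> x by (auto simp: bij_betw_def)
    define \<delta> where "\<delta> = of_int q * (\<theta> i * R / (2 * pi)) - of_int (p i)"
    have "x * (of_int q * R) = 2 * pi * \<delta> + 2 * pi * of_int (p i)"
      by (simp add: \<delta>_def i field_simps)
    then have c: "cis (x * (of_int q * R)) = cis (2 * pi * \<delta>)" by (simp only: cis_add_2pi_int)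
    have "norm (cis (2 * pi * \<delta>) - 1) \<le> \<bar>2 * pi * \<delta>\<bar>" by (rule norm_cis_minus_one_le)
    also have "\<dots> = 2 * pi * \<bar>\<delta>\<bar>" by (simp add: abs_mult)
    also have "\<dots> \<le> 2 * pi * (1 / N)"
      using qp(2)[OF i(1)] by (intro mult_left_mono) (auto simp: \<delta>_def)
    also have "\<dots> < e/2" using N by simp
    finally have d: "norm (cis (2 * pi * \<delta>) - 1) < e/2" .
    have "cis (x * ?t) - u x = cis (x * s j) * (cis (2 * pi * \<delta>) - 1) + (cis (x * s j) - u x)"
    proof -
      have "cis (x * ?t) = cis (x * s j) * cis (x * (of_int q * R))"
        by (simp add: cis_mult distrib_left)
      then show ?thesis unfolding c by (simp add: algebra_simps)
    qed
    then have "norm (cis (x * ?t) - u x) \<le> norm (cis (x * s j) * (cis (2 * pi * \<delta>) - 1)) + norm (cis (x * s j) - u x)"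
      by (metis norm_triangle_ineq)
    then show ?thesis using d j x by (fastforce simp: norm_mult dist_norm)
  qed
  ultimately show ?thesis by blast
qed

end

text \<open>Subtracting the linear function with the same value at 1 leaves an additive function
  that vanishes on the integers. It is thus periodic with period 1 and bounded, and a bounded
  additive function is zero.\<close>

lemma additive_bounded_imp_linear:
  fixes g :: "real \<Rightarrow> real"
  assumes add: "\<And>x y. g (x + y) = g x + g y" and bd: "\<And>x. \<bar>g x\<bar> \<le> C * \<bar>x\<bar>"
  shows "g x = x * g 1"
proof -
  define k where "k x = g x - x * g 1" for x
  have kadd: "k (x + y) = k x + k y" for x y by (simp add: k_def add algebra_simps)
  have knat: "k (of_nat n * x) = of_nat n * k x" for n x
  proof (induction n)
    case 0
    show ?case using kadd[of 0 0] by simp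
  next
    case (Suc n)
    then show ?case using kadd[of x "of_nat n * x"] by (simp add: algebra_simps)
  qed
  have k1: "k 1 = 0" by (simp add: k_def)
  have kint: "k (of_int m) = 0" for m
  proof (cases "m \<ge> 0")
    case True
    then show ?thesis using knat[of "nat m" 1] k1 by simp
  next
    case False
    then have "k (- of_int m) = 0" using knat[of "nat (-m)" 1] k1 by simp
    moreover have "k (of_int m) + k (- of_int m) = 0" using kadd[of "of_int m" "- of_int m"] knat[of 0 1] by simp
    ultimately show ?thesis by simp
  qed
  have C0: "0 \<le> C" using bd[of 1] abs_ge_zero[of "g 1"] by (simp del: abs_ge_zero)
  have kb: "\<bar>k x\<bar> \<le> 2 * C" for x
  proof -
    have "k x = k (frac x)" using kadd[of "of_int \<lfloor>x\<rfloor>" "frac x"] kint[of "\<lfloor>x\<rfloor>"] by (simp add: frac_def)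
    moreover have f: "0 \<le> frac x" "frac x \<le> 1" using frac_lt_1[of x] by (auto intro: less_imp_le)
    have "\<bar>g (frac x)\<bar> \<le> C" using bd[of "frac x"] f C0 mult_left_mono[of "frac x" 1 C] by simp
    moreover have "\<bar>frac x * g 1\<bar> \<le> 1 * C" unfolding abs_mult
      using bd[of 1] f by (intro mult_mono) auto
    ultimately show ?thesis unfolding k_def[of "frac x"] by linarith
  qed
  have "k x = 0"
  proof (rule ccontr)
    assume "k x \<noteq> 0"
    then obtain n :: nat where "2 * C < of_nat n * \<bar>k x\<bar>" using reals_Archimedean3[of "\<bar>k x\<bar>"] by auto
    then show False using kb[of "of_nat n * x"] by (simp add: knat abs_mult)
  qed
  then show ?thesis by (simp add: k_def)
qed

section \<open>Asymptotics at a boundary point\<close>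

text \<open>The asymptotics is stated by a difference and not by a quotient, so that
  \<open>c = 0\<close> is allowed; for \<open>c = 0\<close> or \<open>l = 0\<close> it just says
  that \<open>h\<close> has the limit \<open>c\<close>.\<close>

definition local_form :: "(complex \<Rightarrow> complex) \<Rightarrow> complex \<Rightarrow> complex \<Rightarrow> real \<Rightarrow> bool" where
  "local_form h \<zeta> c l \<longleftrightarrow>
     ((\<lambda>z. h z - c * exp (of_real l * log_angle \<zeta> z)) \<longlongrightarrow> 0) (at \<zeta> within unit_disk)"

lemma tendsto_bounded_mult_zero:
  fixes f g :: "complex \<Rightarrow> complex"
  assumes "(f \<longlongrightarrow> 0) (at \<zeta> within unit_disk)" "\<And>z. z \<in> unit_disk \<Longrightarrow> norm (g z) \<le> M"
  shows "((\<lambda>z. f z * g z) \<longlongrightarrow> 0) (at \<zeta> within unit_disk)"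
proof (rule Lim_null_comparison)
  show "\<forall>\<^sub>F z in at \<zeta> within unit_disk. norm (f z * g z) \<le> norm (f z) * M"
    using eventually_in_disk by eventually_elim (simp add: norm_mult mult_left_mono assms(2))
  show "((\<lambda>z. norm (f z) * M) \<longlongrightarrow> 0) (at \<zeta> within unit_disk)"
    using assms(1) by (intro tendsto_mult_left_zero tendsto_norm_zero)
qed

text \<open>The model functions are bounded on the disk because the real part of the logarithm is,
  so every error term in the expanded product tends to 0.\<close>

lemma local_form_mult:
  assumes \<zeta>: "norm \<zeta> = 1" and h: "local_form h \<zeta> c l" and k: "local_form k \<zeta> d m"
  shows "local_form (\<lambda>z. h z * k z) \<zeta> (c * d) (l + m)"
proof -
  let ?e = "\<lambda>l z. exp (of_real l * log_angle \<zeta> z)"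
  have eq: "h z * k z - c * d * ?e (l + m) z =
      (h z - c * ?e l z) * (k z - d * ?e m z) + (h z - c * ?e l z) * (d * ?e m z)
       + (k z - d * ?e m z) * (c * ?e l z)" for z
    by (simp add: distrib_right exp_add algebra_simps)
  have h': "((\<lambda>z. h z - c * ?e l z) \<longlongrightarrow> 0) (at \<zeta> within unit_disk)"
    and k': "((\<lambda>z. k z - d * ?e m z) \<longlongrightarrow> 0) (at \<zeta> within unit_disk)"
    using h k by (auto simp: local_form_def)
  have b: "norm (c * ?e l z) \<le> norm c * exp (\<bar>l\<bar> * (pi / 2))" if "z \<in> unit_disk" for z c l
    unfolding norm_mult using that norm_exp_log_angle_le[OF \<zeta>, of z l] by (intro mult_left_mono) auto
  have "((\<lambda>z. (h z - c * ?e l z) * (k z - d * ?e m z) + (h z - c * ?e l z) * (d * ?e m z)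
       + (k z - d * ?e m z) * (c * ?e l z)) \<longlongrightarrow> 0 * 0 + 0 + 0) (at \<zeta> within unit_disk)"
    by (intro tendsto_add tendsto_mult[OF h' k'] tendsto_bounded_mult_zero[OF h' b] tendsto_bounded_mult_zero[OF k' b])
  then show ?thesis unfolding local_form_def eq by simp
qed

lemma local_form_limit:
  assumes "(h \<longlongrightarrow> c) (at \<zeta> within unit_disk)"
  shows "local_form h \<zeta> c 0"
  using assms unfolding local_form_def by (auto intro: LIM_zero)

lemma limit_local_form:
  assumes "local_form h \<zeta> c l" "c = 0 \<or> l = 0"
  shows "(h \<longlongrightarrow> c) (at \<zeta> within unit_disk)"
  using assms unfolding local_form_def by (auto intro: LIM_zero_cancel)

lemma local_form_scale:
  "local_form h \<zeta> c l \<Longrightarrow> local_form (\<lambda>z. a * h z) \<zeta> (a * c) l"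
  unfolding local_form_def using tendsto_mult_right_zero[of _ _ a] by (fastforce simp: algebra_simps)

lemma local_form_cong:
  assumes "local_form h \<zeta> c l" "\<And>z. z \<in> unit_disk \<Longrightarrow> k z = h z"
  shows "local_form k \<zeta> c l"
proof -
  have "\<forall>\<^sub>F z in at \<zeta> within unit_disk. h z - c * exp (of_real l * log_angle \<zeta> z) = k z - c * exp (of_real l * log_angle \<zeta> z)"
    using eventually_in_disk by eventually_elim (simp add: assms(2))
  with assms(1) show ?thesis unfolding local_form_def by (rule Lim_transform_eventually)
qed

section \<open>Points of the disk with a prescribed value of \<open>log_angle\<close>\<close>

context
  fixes \<zeta> :: complex and x t :: real
  assumes \<zeta>: "norm \<zeta> = 1" and x: "\<bar>x\<bar> < pi / 2" and t: "exp (- t) < 2 * cos x"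
begin

text \<open>The point is found by solving \<open>1 - z / \<zeta> = exp (Complex (- t) x)\<close>.
  The squared norm of \<open>1 - exp (Complex (- t) x)\<close> is 1 - exp (-t) (2 cos x - exp (-t)),
  which explains the condition on \<open>t\<close>.\<close>

lemma half_strip_point_in_disk: "\<zeta> * (1 - exp (Complex (- t) x)) \<in> unit_disk"
proof -
  let ?w = "exp (Complex (- t) x)"
  have "(1 - e * c)\<^sup>2 + (e * s)\<^sup>2 = 1 - e * (2 * c - e)" if "s\<^sup>2 + c\<^sup>2 = 1" for e c s :: real
    using that by algebra
  from this[OF sin_cos_squared_add[of x], of "exp (- t)"]
  have "norm (1 - ?w) ^ 2 = 1 - exp (- t) * (2 * cos x - exp (- t))"
    by (simp add: cmod_power2 Re_exp Im_exp)
  also have "\<dots> < 1" using t by simp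
  finally have "norm (1 - ?w) ^ 2 < 1 ^ 2" by simp
  then have "norm (1 - ?w) < 1" by (rule power2_less_imp_less) simp
  then show ?thesis using \<zeta> by (simp add: norm_mult)
qed

lemma log_angle_half_strip_point:
  "log_angle \<zeta> (\<zeta> * (1 - exp (Complex (- t) x))) = Complex x t"
proof -
  have "\<zeta> \<noteq> 0" using \<zeta> by auto
  then have "1 - \<zeta> * (1 - exp (Complex (- t) x)) / \<zeta> = exp (Complex (- t) x)" by simp
  moreover have "Ln (exp (Complex (- t) x)) = Complex (- t) x"
    using x by (intro Ln_exp) auto
  ultimately show ?thesis unfolding log_angle_def by (simp only:) (simp add: complex_eq_iff)
qed

end

lemma exp_times_Complex: "exp (of_real l * Complex x t) = of_real (exp (l * x)) * cis (l * t)"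
  by (simp add: complex_eq_iff Re_exp Im_exp)

section \<open>Values of a character on functions with known asymptotics\<close>

context disk_character
begin

text \<open>The difference of \<open>h\<close> and \<open>c\<close> times \<open>H\<close> tends to
  0 at the base point, so the character does not see it. In particular the value on \<open>H\<close>
  depends only on the exponent \<open>l\<close>.\<close>

lemma phi_local_form:
  assumes bp: "norm base_point = 1"
    and h: "h \<in> alg" "local_form h base_point c l" and H: "H \<in> alg" "local_form H base_point 1 l"
  shows "\<phi> h = c * \<phi> H"
proof -
  let ?e = "\<lambda>z. exp (of_real l * log_angle base_point z)"
  have "((\<lambda>z. (h z - c * ?e z) - c * (H z - 1 * ?e z)) \<longlongrightarrow> 0 - c * 0) (at base_point within unit_disk)"
    using h(2) H(2) unfolding local_form_def by (intro tendsto_intros)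
  then have "((\<lambda>z. h z - c * H z) \<longlongrightarrow> 0) (at base_point within unit_disk)"
    by (simp add: algebra_simps)
  then have "\<phi> (\<lambda>z. h z - c * H z) = 0"
    using bp h(1) H(1) by (intro phi_eq_limit alg_diff alg_scale)
  then show ?thesis using phi_diff[OF h(1) alg_scale[OF H(1)]] phi_scale[OF H(1)] by simp
qed

lemma norm_phi_local_form_le:
  assumes bp: "norm base_point = 1" and H: "H \<in> alg" "local_form H base_point 1 l"
  shows "norm (\<phi> H) \<le> exp (\<bar>l\<bar> * (pi / 2))"
proof (rule field_le_epsilon)
  fix e :: real assume "e > 0"
  have "\<forall>\<^sub>F z in at base_point within unit_disk. dist (H z - 1 * exp (of_real l * log_angle base_point z)) 0 < e"
    using H(2) \<open>e > 0\<close> unfolding local_form_def by (rule tendstoD)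
  then have "\<forall>\<^sub>F z in at base_point within unit_disk. norm (H z) \<le> exp (\<bar>l\<bar> * (pi / 2)) + e"
    using eventually_in_disk
  proof eventually_elim
    case (elim z)
    then show ?case
      using norm_exp_log_angle_le[OF bp, of z l]
        norm_triangle_sub[of "H z" "exp (of_real l * log_angle base_point z)"]
      unfolding dist_norm mult_1 diff_0_right mem_ball_0 by linarith
  qed
  then show "norm (\<phi> H) \<le> exp (\<bar>l\<bar> * (pi / 2)) + e" by (rule phi_norm_le_local[OF bp H(1)])
qed

text \<open>The values on the model functions form a homomorphism from the reals to the nonzero
  complex numbers. Its modulus prescribes the real part of the logarithm along the sequence, and its
  unitary part the imaginary part.\<close>

lemma boundary_sequence:
  assumes bp: "norm base_point = 1"
    and H: "\<And>l. H l \<in> alg" "\<And>l. local_form (H l) base_point 1 l"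
    and K: "finite K" "K \<subseteq> alg" "\<And>k. k \<in> K \<Longrightarrow> \<exists>c l. local_form k base_point c l"
  shows "\<exists>z. (\<forall>n. z n \<in> unit_disk) \<and> (\<forall>k\<in>K. (\<lambda>n. k (z n)) \<longlonglongrightarrow> \<phi> k)"
proof -
  let ?\<zeta> = base_point
  define ch where "ch l = \<phi> (H l)" for l
  have chi_add: "ch (l + m) = ch l * ch m" for l m
  proof -
    have "\<phi> (\<lambda>z. H l z * H m z) = 1 * 1 * \<phi> (H (l + m))"
      by (rule phi_local_form[OF bp alg_mult[OF H(1) H(1)] local_form_mult[OF bp H(2) H(2)] H(1) H(2)])
    then show ?thesis by (simp add: ch_def phi_mult H)
  qed
  have chi_0: "ch 0 = 1"
  proof -
    have "(on_disk (\<lambda>_. 1) \<longlongrightarrow> 1) (at ?\<zeta> within unit_disk)"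
      by (rule tendsto_eventually)
         (use eventually_in_disk[of ?\<zeta>] in eventually_elim, simp add: on_disk_def)
    then have "\<phi> (on_disk (\<lambda>_. 1)) = 1 * \<phi> (H 0)"
      by (intro phi_local_form[OF bp alg_const local_form_limit H])
    then show ?thesis by (simp add: ch_def phi_one)
  qed
  have chi_nz: "ch l \<noteq> 0" for l using chi_add[of l "-l"] chi_0 by auto
  define x where "x = ln (norm (ch 1))"
  have chi_le: "ln (norm (ch l)) \<le> \<bar>l\<bar> * (pi / 2)" for l
  proof -
    have "norm (ch l) \<le> exp (\<bar>l\<bar> * (pi / 2))"
      unfolding ch_def by (rule norm_phi_local_form_le[OF bp H])
    then have "ln (norm (ch l)) \<le> ln (exp (\<bar>l\<bar> * (pi / 2)))"
      using chi_nz[of l] by (subst ln_le_cancel_iff) auto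
    then show ?thesis by simp
  qed
  have ln_add: "ln (norm (ch (l + m))) = ln (norm (ch l)) + ln (norm (ch m))" for l m
    using chi_nz by (simp add: chi_add norm_mult ln_mult)
  \<comment> \<open>The lower bound is the upper bound for the exponent -l, as the values at
    \<open>l\<close> and \<open>-l\<close> multiply to 1.\<close>
  have bd: "\<bar>ln (norm (ch l))\<bar> \<le> (pi / 2) * \<bar>l\<bar>" for l
    using chi_le[of l] chi_le[of "-l"] ln_add[of l "-l"] chi_0 by (simp add: abs_le_iff mult.commute)
  have lin: "ln (norm (ch l)) = l * x" for l
    unfolding x_def by (rule additive_bounded_imp_linear[OF ln_add bd])
  have norm_chi: "norm (ch l) = exp (l * x)" for l
    using lin[of l] chi_nz[of l] by (metis exp_ln zero_less_norm_iff)
  have xb: "\<bar>x\<bar> \<le> pi / 2" using bd[of 1] by (simp add: x_def)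
  define u where "u l = ch l / of_real (exp (l * x))" for l
  interpret unitary_hom u
    by unfold_locales (simp_all add: u_def norm_divide norm_chi chi_add distrib_right exp_add)
  have chi_u: "ch l = of_real (exp (l * x)) * u l" for l by (simp add: u_def)
  obtain c l where cl: "\<And>k. k \<in> K \<Longrightarrow> local_form k ?\<zeta> (c k) (l k)" using K(3) by metis
  \<comment> \<open>The value \<open>x\<close> may lie on the edge of the strip, which no point of
    the disk reaches; it is approached from inside by factors from 1/2 up towards 1.\<close>
  define X where "X n = x * (1 - inverse (real (Suc (Suc n))))" for n
  have Xb: "\<bar>X n\<bar> < pi / 2" for n
  proof -
    have "0 \<le> 1 - inverse (real (Suc (Suc n)))" "1 - inverse (real (Suc (Suc n))) < 1"
      by (auto simp: field_simps)
    then have "\<bar>X n\<bar> \<le> (pi / 2) * (1 - inverse (real (Suc (Suc n))))"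
      unfolding X_def abs_mult using xb by (intro mult_mono) auto
    also have "\<dots> < (pi / 2) * 1" by (intro mult_strict_left_mono) auto
    finally show ?thesis by simp
  qed
  have Xlim: "X \<longlonglongrightarrow> x"
  proof -
    have "(\<lambda>n. x * (1 - inverse (real (Suc (Suc n))))) \<longlonglongrightarrow> x * (1 - 0)"
      by (intro tendsto_intros LIMSEQ_Suc[OF LIMSEQ_inverse_real_of_nat])
    then show ?thesis by (simp add: X_def[abs_def])
  qed
  \<comment> \<open>The summand \<open>real n\<close> forces convergence to the base point, the
    logarithm puts the point inside the disk, and 1 makes that inequality strict.\<close>
  have "\<exists>t\<ge>real n + 1 + \<bar>ln (2 * cos (X n))\<bar>. \<forall>y\<in>l ` K. norm (cis (y * t) - u y) < inverse (real (Suc n))" for n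
    using K(1) by (intro simultaneous_approx) auto
  then obtain t where t: "\<And>n. t n \<ge> real n + 1 + \<bar>ln (2 * cos (X n))\<bar>"
      "\<And>n y. y \<in> l ` K \<Longrightarrow> norm (cis (y * t n) - u y) < inverse (real (Suc n))"
    by metis
  have tcos: "exp (- t n) < 2 * cos (X n)" for n
  proof -
    have "0 < 2 * cos (X n)" using Xb[of n] by (simp add: cos_gt_zero_pi abs_less_iff)
    moreover have "- t n < ln (2 * cos (X n))" using t(1)[of n] by linarith
    ultimately show ?thesis by (metis exp_less_cancel_iff exp_ln)
  qed
  define z where "z n = ?\<zeta> * (1 - exp (Complex (- t n) (X n)))" for n
  have zd: "z n \<in> unit_disk" for n
    unfolding z_def by (rule half_strip_point_in_disk[OF bp Xb tcos])
  have zl: "log_angle ?\<zeta> (z n) = Complex (X n) (t n)" for n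
    unfolding z_def by (rule log_angle_half_strip_point[OF bp Xb tcos])
  have zlim: "z \<longlonglongrightarrow> ?\<zeta>"
  proof -
    have "(\<lambda>n. exp (- t n)) \<longlonglongrightarrow> 0"
    proof (rule tendsto_sandwich[OF _ _ tendsto_const])
      show "\<forall>\<^sub>F n in sequentially. exp (- t n) \<le> exp (- real n)"
        using t(1) by (intro always_eventually allI) (smt (verit) abs_ge_zero exp_le_cancel_iff)
      show "(\<lambda>n. exp (- real n)) \<longlonglongrightarrow> 0"
        by (intro filterlim_compose[OF exp_at_bot] filterlim_compose[OF filterlim_uminus_at_bot_at_top] filterlim_real_sequentially)
    qed auto
    then have "(\<lambda>n. norm (exp (Complex (- t n) (X n)))) \<longlonglongrightarrow> 0" by simp
    then have "(\<lambda>n. exp (Complex (- t n) (X n))) \<longlonglongrightarrow> 0"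
      by (rule tendsto_norm_zero_cancel)
    from tendsto_mult[OF tendsto_const tendsto_diff[OF tendsto_const this]]
    have "z \<longlonglongrightarrow> ?\<zeta> * (1 - 0)" unfolding z_def[abs_def] .
    then show ?thesis by simp
  qed
  have zat: "filterlim z (at ?\<zeta> within unit_disk) sequentially"
  proof -
    have "z n \<noteq> ?\<zeta>" for n using zd[of n] bp by auto
    then show ?thesis using zlim zd by (simp add: filterlim_at)
  qed
  have "(\<lambda>n. k (z n)) \<longlonglongrightarrow> \<phi> k" if k: "k \<in> K" for k
  proof -
    have "(\<lambda>n. cis (l k * t n) - u (l k)) \<longlonglongrightarrow> 0"
      using t(2)[of "l k"] k
      by (intro Lim_null_comparison[OF _ LIMSEQ_inverse_real_of_nat]) (auto intro!: always_eventually less_imp_le)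
    then have "(\<lambda>n. cis (l k * t n)) \<longlonglongrightarrow> u (l k)" by (rule LIM_zero_cancel)
    \<comment> \<open>Modulus and unitary part converge separately; their product is the model
      function at the points \<open>z n\<close>.\<close>
    then have "(\<lambda>n. of_real (exp (l k * X n)) * cis (l k * t n)) \<longlonglongrightarrow> of_real (exp (l k * x)) * u (l k)"
      by (intro tendsto_intros Xlim)
    then have e: "(\<lambda>n. exp (of_real (l k) * log_angle ?\<zeta> (z n))) \<longlonglongrightarrow> ch (l k)"
      unfolding zl exp_times_Complex chi_u .
    have "(\<lambda>n. k (z n) - c k * exp (of_real (l k) * log_angle ?\<zeta> (z n))) \<longlonglongrightarrow> 0"
      using filterlim_compose[OF cl[OF k, unfolded local_form_def] zat] .
    from tendsto_add[OF this tendsto_mult_left[OF e, of "c k"]]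
    have "(\<lambda>n. k (z n)) \<longlonglongrightarrow> c k * ch (l k)" by simp
    also have "c k * ch (l k) = \<phi> k"
      using k K(2) unfolding ch_def by (subst phi_local_form[OF bp _ cl[OF k] H(1) H(2)]) auto
    finally show ?thesis .
  qed
  with zd show ?thesis by blast
qed

section \<open>Reduction from the generated algebra to finitely many generators\<close>

definition determines :: "(complex \<Rightarrow> complex) set \<Rightarrow> (complex \<Rightarrow> complex) \<Rightarrow> bool" where
  "determines K h \<longleftrightarrow>
    (\<forall>z::nat \<Rightarrow> complex. (\<forall>k\<in>K. (\<lambda>n. k (z n)) \<longlonglongrightarrow> \<phi> k) \<longrightarrow> (\<lambda>n. h (z n)) \<longlonglongrightarrow> \<phi> h)"

lemma determines_mono: "determines K h \<Longrightarrow> K \<subseteq> L \<Longrightarrow> determines L h"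
  unfolding determines_def by (meson subsetD)

lemma determinesD:
  fixes z :: "nat \<Rightarrow> complex"
  shows "determines K h \<Longrightarrow> (\<And>k. k \<in> K \<Longrightarrow> (\<lambda>n. k (z n)) \<longlonglongrightarrow> \<phi> k) \<Longrightarrow> (\<lambda>n. h (z n)) \<longlonglongrightarrow> \<phi> h"
  unfolding determines_def by simp

text \<open>Limits respect sums and products, so convergence on the finitely many generators from
  which \<open>h\<close> is built carries over to \<open>h\<close>. The sequential formulation
  avoids writing \<open>h\<close> as a polynomial in them.\<close>

lemma generated_algebra_determined:
  assumes "h \<in> generated_algebra G"
  shows "\<exists>K. finite K \<and> K \<subseteq> G \<and> determines K h"
  using assms
proof (induction rule: generated_algebra.induct)
  case (gen h)
  have "determines {h} h" by (simp add: determines_def)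
  then show ?case using gen by (intro exI[of _ "{h}"]) simp
next
  case (add h k)
  then obtain K L where KL: "finite K" "K \<subseteq> G" "finite L" "L \<subseteq> G" "determines K h" "determines L k"
    by blast
  then have d: "determines (K \<union> L) h" "determines (K \<union> L) k" by (auto intro: determines_mono)
  have "\<phi> (\<lambda>z. h z + k z) = \<phi> h + \<phi> k" using add by (intro phi_add generated_alg)
  then have "determines (K \<union> L) (\<lambda>z. h z + k z)"
    using tendsto_add[OF determinesD[OF d(1)] determinesD[OF d(2)]] by (simp add: determines_def)
  with KL show ?case by (intro exI[of _ "K \<union> L"]) simp
next
  case (mult h k)
  then obtain K L where KL: "finite K" "K \<subseteq> G" "finite L" "L \<subseteq> G" "determines K h" "determines L k"
    by blast
  then have d: "determines (K \<union> L) h" "determines (K \<union> L) k" by (auto intro: determines_mono)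
  have "\<phi> (\<lambda>z. h z * k z) = \<phi> h * \<phi> k" using mult by (intro phi_mult generated_alg)
  then have "determines (K \<union> L) (\<lambda>z. h z * k z)"
    using tendsto_mult[OF determinesD[OF d(1)] determinesD[OF d(2)]] by (simp add: determines_def)
  with KL show ?case by (intro exI[of _ "K \<union> L"]) simp
next
  case (scale h c)
  then obtain K where K: "finite K" "K \<subseteq> G" "determines K h" by blast
  have "\<phi> (\<lambda>z. c * h z) = c * \<phi> h" using scale by (intro phi_scale generated_alg)
  then have "determines K (\<lambda>z. c * h z)"
    using tendsto_mult_left[OF determinesD[OF K(3)]] by (simp add: determines_def)
  with K show ?case by blast
qed

end

section \<open>Density of the disk\<close>

text \<open>The first condition serves the characters over interior points. The second serves those
  over boundary points: either every generator has a limit there, or the model functions of all real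
  exponents are available.\<close>

locale tame_algebra = disk_function_algebra +
  assumes gens_limits: "k \<in> G \<Longrightarrow>
      \<exists>F. finite F \<and> F \<subseteq> unit_circle \<and> (\<forall>\<zeta>\<in>unit_circle - F. \<exists>l. (k \<longlongrightarrow> l) (at \<zeta> within unit_disk))"
    and gens_local: "k \<in> G \<Longrightarrow> norm \<zeta> = 1 \<Longrightarrow>
      \<exists>c l. local_form k \<zeta> c l \<and> (c \<noteq> 0 \<and> l \<noteq> 0 \<longrightarrow> (\<forall>m. \<exists>H\<in>alg. local_form H \<zeta> 1 m))"

locale tame_character = disk_character + tame_algebra
begin

text \<open>Over an interior point the constant sequence works; over a boundary point either
  \<open>boundary_sequence\<close> applies or all generators are continuous there.\<close>

lemma gens_sequence:
  assumes K: "finite K" "K \<subseteq> G"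
  shows "\<exists>z. (\<forall>n. z n \<in> unit_disk) \<and> (\<forall>k\<in>K. (\<lambda>n. k (z n)) \<longlonglongrightarrow> \<phi> k)"
proof (cases "norm base_point < 1")
  case True
  have "\<phi> k = k base_point" if k: "k \<in> K" for k
  proof -
    have "k \<in> G" using k K by blast
    then obtain F where "finite F" "F \<subseteq> unit_circle"
        "\<forall>\<zeta>\<in>unit_circle - F. \<exists>l. (k \<longlongrightarrow> l) (at \<zeta> within unit_disk)"
      using gens_limits[OF \<open>k \<in> G\<close>] by blast
    then show ?thesis using True gens_alg[OF \<open>k \<in> G\<close>] by (intro phi_interior[of k F]) auto
  qed
  with True show ?thesis by (intro exI[of _ "\<lambda>_. base_point"]) auto
next
  case False
  then have bp: "norm base_point = 1" using norm_base_point_le by simp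
  have alg: "k \<in> alg" if "k \<in> K" for k using that K gens_alg by blast
  show ?thesis
  proof (cases "\<forall>m. \<exists>H\<in>alg. local_form H base_point 1 m")
    case True
    then obtain H where "\<And>m. H m \<in> alg" "\<And>m. local_form (H m) base_point 1 m" by metis
    then show ?thesis using K gens_local[OF _ bp] alg by (intro boundary_sequence[OF bp]) blast+
  next
    case triv: False
    \<comment> \<open>If some exponent has no model function, no generator can have both
      \<open>c\<close> and \<open>l\<close> nonzero. All of them then have limits, and any sequence
      tending to the base point will do.\<close>
    have lim: "(k \<longlongrightarrow> \<phi> k) (at base_point within unit_disk)" if k: "k \<in> K" for k
    proof -
      have "k \<in> G" using k K by blast
      then obtain c l where "local_form k base_point c l" "c = 0 \<or> l = 0"
        using gens_local[OF _ bp] triv by blast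
      then have "(k \<longlongrightarrow> c) (at base_point within unit_disk)" by (rule limit_local_form)
      then show ?thesis using phi_eq_limit[OF bp alg[OF k]] by metis
    qed
    have "base_point islimpt unit_disk" using bp islimpt_ball[of base_point "0::complex" 1] by simp
    then obtain z where z: "\<And>n. z n \<in> unit_disk - {base_point}" "z \<longlonglongrightarrow> base_point"
      unfolding islimpt_sequential by blast
    then have "filterlim z (at base_point within unit_disk) sequentially" by (auto simp: filterlim_at)
    then have "\<forall>k\<in>K. (\<lambda>n. k (z n)) \<longlonglongrightarrow> \<phi> k" using lim filterlim_compose by blast
    then show ?thesis using z by blast
  qed
qed

text \<open>Three errors of e/3: from \<open>h\<close> to a generated function at the point, from
  that point to the character on the generated function, and back to \<open>h\<close> under the
  character.\<close>

lemma approx_by_point: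
  assumes K: "finite K" "K \<subseteq> alg" and e: "e > 0"
  shows "\<exists>z\<in>unit_disk. \<forall>h\<in>K. norm (h z - \<phi> h) < e"
proof -
  have "\<forall>h\<in>K. \<exists>k. k \<in> generated_algebra G \<and> (\<forall>z\<in>unit_disk. norm (h z - k z) < e/3)"
    using K(2) e alg_approx[of _ "e/3"] by (metis divide_pos_pos subsetD zero_less_numeral)
  then obtain k where k: "\<And>h. h \<in> K \<Longrightarrow> k h \<in> generated_algebra G"
      "\<And>h z. h \<in> K \<Longrightarrow> z \<in> unit_disk \<Longrightarrow> norm (h z - k h z) < e/3"
    by metis
  have "\<forall>h\<in>K. \<exists>L. finite L \<and> L \<subseteq> G \<and> determines L (k h)"
    using generated_algebra_determined k(1) by blast
  then obtain L where L: "\<And>h. h \<in> K \<Longrightarrow> finite (L h)" "\<And>h. h \<in> K \<Longrightarrow> L h \<subseteq> G"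
      "\<And>h. h \<in> K \<Longrightarrow> determines (L h) (k h)"
    by metis
  have "finite (\<Union>h\<in>K. L h)" "(\<Union>h\<in>K. L h) \<subseteq> G" using K(1) L by auto
  then obtain z where z: "\<And>n. z n \<in> unit_disk" "\<forall>k\<in>(\<Union>h\<in>K. L h). (\<lambda>n. k (z n)) \<longlonglongrightarrow> \<phi> k"
    using gens_sequence by blast
  have "\<forall>\<^sub>F n in sequentially. \<forall>h\<in>K. dist (k h (z n)) (\<phi> (k h)) < e/3"
  proof (intro eventually_ball_finite ballI K(1))
    fix h assume "h \<in> K"
    then have "(\<lambda>n. k h (z n)) \<longlonglongrightarrow> \<phi> (k h)" using z(2) by (intro determinesD[OF L(3)]) auto
    then show "\<forall>\<^sub>F n in sequentially. dist (k h (z n)) (\<phi> (k h)) < e/3"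
      by (rule tendstoD) (use e in simp)
  qed
  then obtain n where n: "\<forall>h\<in>K. dist (k h (z n)) (\<phi> (k h)) < e/3"
    by (auto simp: eventually_sequentially)
  have "norm (h (z n) - \<phi> h) < e" if h: "h \<in> K" for h
  proof -
    have ha: "h \<in> alg" "k h \<in> alg" using h K(2) k(1) generated_alg by auto
    have "norm (\<phi> (\<lambda>z. h z - k h z)) \<le> e/3"
      using k(2)[OF h] by (intro phi_norm_le alg_diff ha) (auto intro: less_imp_le)
    then have "norm (\<phi> h - \<phi> (k h)) \<le> e/3" by (simp add: phi_diff ha)
    moreover have "norm (h (z n) - k h (z n)) < e/3" by (rule k(2)[OF h z(1)])
    moreover have "norm (k h (z n) - \<phi> (k h)) < e/3" using n h by (simp add: dist_norm)
    ultimately show ?thesis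
      using norm_triangle_ineq[of "h (z n) - k h (z n)" "k h (z n) - \<phi> (k h)"]
        norm_triangle_ineq4[of "h (z n) - \<phi> (k h)" "\<phi> h - \<phi> (k h)"] by simp
  qed
  with z(1) show ?thesis by blast
qed

end

context tame_algebra
begin

text \<open>A basic neighbourhood in the product topology restricts only finitely many coordinates,
  which reduces density to simultaneous approximation on a finite set.\<close>

theorem disk_dense_in_max_ideal_space:
  "gelfand_topology alg closure_of (point_eval alg ` unit_disk) = max_ideal_space alg"
proof -
  let ?P = "product_topology (\<lambda>_. euclidean) alg :: ((complex \<Rightarrow> complex) \<Rightarrow> complex) topology"
  have ts: "topspace (gelfand_topology alg) = max_ideal_space alg"
    by (auto simp: gelfand_topology_def max_ideal_space_def PiE_def)
  have "\<phi> \<in> gelfand_topology alg closure_of (point_eval alg ` unit_disk)" if \<phi>: "\<phi> \<in> max_ideal_space alg" for \<phi>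
    unfolding in_closure_of
  proof (intro conjI allI impI)
    show "\<phi> \<in> topspace (gelfand_topology alg)" using \<phi> ts by simp
    interpret tame_character G \<phi> by unfold_locales (rule \<phi>)
    fix T assume "\<phi> \<in> T \<and> openin (gelfand_topology alg) T"
    then obtain V where V: "openin ?P V" "T = V \<inter> max_ideal_space alg" "\<phi> \<in> V"
      unfolding gelfand_topology_def openin_subtopology by blast
    have "\<exists>U. finite {i \<in> alg. U i \<noteq> UNIV} \<and> (\<forall>i\<in>alg. open (U i)) \<and> \<phi> \<in> Pi\<^sub>E alg U \<and> Pi\<^sub>E alg U \<subseteq> V"
      using bspec[OF V(1)[unfolded openin_product_topology_alt] V(3)]
      by (simp only: open_openin topspace_euclidean)
    then obtain U where U: "finite {i \<in> alg. U i \<noteq> UNIV}" "\<forall>i\<in>alg. open (U i)" "\<phi> \<in> Pi\<^sub>E alg U" "Pi\<^sub>E alg U \<subseteq> V"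
      by blast
    let ?K = "{i \<in> alg. U i \<noteq> UNIV}"
    have "\<forall>i\<in>?K. \<exists>e>0. ball (\<phi> i) e \<subseteq> U i"
      using U(2,3) by (auto simp: PiE_iff open_contains_ball)
    then have "\<exists>e. \<forall>i\<in>?K. e i > 0 \<and> ball (\<phi> i) (e i) \<subseteq> U i" by (rule bchoice)
    then obtain e where e: "\<And>i. i \<in> ?K \<Longrightarrow> e i > 0" "\<And>i. i \<in> ?K \<Longrightarrow> ball (\<phi> i) (e i) \<subseteq> U i"
      by blast
    \<comment> \<open>The element 1 keeps the minimum defined when no coordinate is
      restricted.\<close>
    define d where "d = Min (insert 1 (e ` ?K))"
    have d: "d > 0" "\<And>i. i \<in> ?K \<Longrightarrow> d \<le> e i" unfolding d_def using U(1) e(1) by auto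
    obtain z where z: "z \<in> unit_disk" "\<forall>h\<in>?K. norm (h z - \<phi> h) < d"
      using approx_by_point[OF U(1) _ d(1)] by blast
    have "i z \<in> U i" if "i \<in> alg" for i
    proof (cases "U i = UNIV")
      case False
      then have i: "i \<in> ?K" using that by simp
      then have "i z \<in> ball (\<phi> i) (e i)" using z(2) d(2) by (fastforce simp: dist_norm norm_minus_commute)
      then show ?thesis using e(2)[OF i] by blast
    qed auto
    then have "point_eval alg z \<in> Pi\<^sub>E alg U" by (simp add: point_eval_def)
    then have "point_eval alg z \<in> T" using U(4) V(2) point_eval_in_max_ideal_space[OF z(1)] by blast
    then show "\<exists>y. y \<in> point_eval alg ` unit_disk \<and> y \<in> T" using z(1) by blast
  qed
  moreover have "gelfand_topology alg closure_of (point_eval alg ` unit_disk) \<subseteq> max_ideal_space alg"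
    using closure_of_subset_topspace ts by metis
  ultimately show ?thesis by blast
qed

end

section \<open>The generators of the algebra\<close>

text \<open>The exponents \<open>f\<close> of all generators take this form on the disk. The points
  are indexed because an endpoint may occur several times.\<close>

definition log_sum :: "'i set \<Rightarrow> complex \<Rightarrow> ('i \<Rightarrow> real) \<Rightarrow> ('i \<Rightarrow> complex) \<Rightarrow> complex \<Rightarrow> complex" where
  "log_sum I \<kappa> d s z = \<kappa> + (\<Sum>i\<in>I. of_real (d i) * log_angle (s i) z)"

lemma log_sum_scale:
  "of_real m * log_sum I \<kappa> d s z = log_sum I (of_real m * \<kappa>) (\<lambda>i. m * d i) s z"
  by (simp add: log_sum_def sum_distrib_left distrib_left mult.assoc)

lemma holomorphic_on_log_sum:
  assumes "\<forall>i\<in>I. norm (s i) = 1"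
  shows "log_sum I \<kappa> d s holomorphic_on unit_disk"
proof -
  have "(\<lambda>z. \<kappa> + (\<Sum>i\<in>I. of_real (d i) * log_angle (s i) z)) holomorphic_on unit_disk"
    using assms by (intro holomorphic_intros holomorphic_on_log_angle) auto
  then show ?thesis by (simp add: log_sum_def[abs_def])
qed

lemma exp_log_sum_Hinf:
  assumes s: "\<forall>i\<in>I. norm (s i) = 1"
  shows "on_disk (\<lambda>z. exp (log_sum I \<kappa> d s z)) \<in> Hinf"
proof (rule HinfI)
  show "(\<lambda>z. exp (log_sum I \<kappa> d s z)) holomorphic_on unit_disk"
    by (intro holomorphic_intros holomorphic_on_log_sum s)
  fix z assume z: "z \<in> unit_disk"
  have "Re (log_sum I \<kappa> d s z) = Re \<kappa> + (\<Sum>i\<in>I. d i * Re (log_angle (s i) z))"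
    by (simp add: log_sum_def)
  also have "\<dots> \<le> Re \<kappa> + (\<Sum>i\<in>I. \<bar>d i\<bar> * (pi / 2))"
  proof (intro add_left_mono sum_mono)
    fix i assume "i \<in> I"
    then have "\<bar>Re (log_angle (s i) z)\<bar> \<le> pi / 2" using z s by (intro Re_log_angle_bound) auto
    then have "\<bar>d i\<bar> * \<bar>Re (log_angle (s i) z)\<bar> \<le> \<bar>d i\<bar> * (pi / 2)" by (intro mult_left_mono) auto
    then show "d i * Re (log_angle (s i) z) \<le> \<bar>d i\<bar> * (pi / 2)"
      using abs_ge_self[of "d i * Re (log_angle (s i) z)"] unfolding abs_mult by linarith
  qed
  finally show "norm (exp (log_sum I \<kappa> d s z)) \<le> exp (Re \<kappa> + (\<Sum>i\<in>I. \<bar>d i\<bar> * (pi / 2)))" by simp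
qed

text \<open>The terms with singularity at \<open>\<zeta>\<close> add up to the exponent; the others
  are continuous there and contribute the nonzero constant.\<close>

lemma local_form_exp_log_sum:
  assumes I: "finite I" and s: "\<forall>i\<in>I. norm (s i) = 1" and \<zeta>: "norm \<zeta> = 1"
  obtains c where "c \<noteq> 0"
    "local_form (\<lambda>z. exp (log_sum I \<kappa> d s z)) \<zeta> c (\<Sum>i\<in>{i\<in>I. s i = \<zeta>}. d i)"
proof -
  let ?J = "{i\<in>I. s i = \<zeta>}" and ?R = "\<lambda>z. exp (\<kappa> + (\<Sum>i\<in>{i\<in>I. s i \<noteq> \<zeta>}. of_real (d i) * log_angle (s i) z))"
  have eq: "exp (log_sum I \<kappa> d s z) = exp (of_real (\<Sum>i\<in>?J. d i) * log_angle \<zeta> z) * ?R z" for z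
  proof -
    have "(\<Sum>i\<in>I. of_real (d i) * log_angle (s i) z)
        = (\<Sum>i\<in>?J. of_real (d i) * log_angle (s i) z) + (\<Sum>i\<in>{i\<in>I. s i \<noteq> \<zeta>}. of_real (d i) * log_angle (s i) z)"
      using I by (subst sum.union_disjoint[symmetric]) (auto intro!: sum.cong)
    also have "(\<Sum>i\<in>?J. of_real (d i) * log_angle (s i) z) = of_real (\<Sum>i\<in>?J. d i) * log_angle \<zeta> z"
      by (simp add: sum_distrib_right)
    finally show ?thesis by (simp add: log_sum_def exp_add[symmetric] algebra_simps)
  qed
  have lim: "(log_angle (s i) \<longlongrightarrow> log_angle (s i) \<zeta>) (at \<zeta> within unit_disk)" if "i \<in> {i\<in>I. s i \<noteq> \<zeta>}" for i
    using continuous_at_log_angle[of "s i" \<zeta>] s that \<zeta>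
    by (auto simp: isCont_def intro: tendsto_within_subset)
  have R: "local_form ?R \<zeta> (?R \<zeta>) 0"
    by (intro local_form_limit tendsto_intros lim)
  have E: "local_form (\<lambda>z. exp (of_real (\<Sum>i\<in>?J. d i) * log_angle \<zeta> z)) \<zeta> 1 (\<Sum>i\<in>?J. d i)"
    by (simp add: local_form_def)
  have "local_form (\<lambda>z. exp (log_sum I \<kappa> d s z)) \<zeta> (1 * ?R \<zeta>) ((\<Sum>i\<in>?J. d i) + 0)"
    unfolding eq by (rule local_form_mult[OF \<zeta> E R])
  then show thesis by (intro that[of "1 * ?R \<zeta>"]) simp_all
qed

text \<open>Along the radius to \<open>\<zeta>\<close> the logarithm is purely imaginary, so the
  function runs around the unit circle. The times \<open>t n\<close> are those at which it
  alternates between -1 and 1.\<close>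

lemma exp_log_angle_no_limit:
  assumes \<zeta>: "norm \<zeta> = 1" and l: "l \<noteq> 0"
  shows "\<not> ((\<lambda>z. exp (of_real l * log_angle \<zeta> z)) \<longlongrightarrow> L) (at \<zeta> within unit_disk)"
proof
  assume lim: "((\<lambda>z. exp (of_real l * log_angle \<zeta> z)) \<longlongrightarrow> L) (at \<zeta> within unit_disk)"
  define t where "t n = pi * of_nat (Suc n) / \<bar>l\<bar>" for n
  have tpos: "t n > 0" for n using l by (simp add: t_def)
  have tlim: "filterlim t at_top sequentially"
  proof -
    have "filterlim (\<lambda>n. (pi / \<bar>l\<bar>) * real (Suc n)) at_top sequentially"
      using l by (intro filterlim_tendsto_pos_mult_at_top[OF tendsto_const] filterlim_compose[OF filterlim_real_sequentially filterlim_Suc]) auto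
    then show ?thesis by (simp add: t_def[abs_def])
  qed
  define z where "z n = \<zeta> * (1 - exp (Complex (- t n) 0))" for n
  have tcos: "exp (- t n) < 2 * cos 0" for n
  proof -
    have "exp (- t n) < exp 0" using tpos[of n] by (simp only: exp_less_cancel_iff)
    then have "exp (- t n) < 1" by (simp only: exp_zero)
    then have "exp (- t n) < 2 * 1" by linarith
    then show ?thesis by (simp only: cos_zero)
  qed
  have x0: "\<bar>0::real\<bar> < pi / 2" by simp
  have zd: "z n \<in> unit_disk" for n
    unfolding z_def by (rule half_strip_point_in_disk[OF \<zeta> x0 tcos])
  have zl: "log_angle \<zeta> (z n) = Complex 0 (t n)" for n
    unfolding z_def by (rule log_angle_half_strip_point[OF \<zeta> x0 tcos])
  have "(\<lambda>n. exp (- t n)) \<longlonglongrightarrow> 0"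
    by (intro filterlim_compose[OF exp_at_bot] filterlim_compose[OF filterlim_uminus_at_bot_at_top] tlim)
  then have "(\<lambda>n. norm (exp (Complex (- t n) 0))) \<longlonglongrightarrow> 0" by simp
  then have "(\<lambda>n. exp (Complex (- t n) 0)) \<longlonglongrightarrow> 0"
    by (rule tendsto_norm_zero_cancel)
  from tendsto_mult[OF tendsto_const tendsto_diff[OF tendsto_const this]]
  have "z \<longlonglongrightarrow> \<zeta> * (1 - 0)" unfolding z_def[abs_def] .
  moreover have "z n \<noteq> \<zeta>" for n using zd[of n] \<zeta> by auto
  ultimately have "filterlim z (at \<zeta> within unit_disk) sequentially"
    using zd by (simp add: filterlim_at)
  then have "(\<lambda>n. exp (of_real l * log_angle \<zeta> (z n))) \<longlonglongrightarrow> L"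
    by (rule filterlim_compose[OF lim])
  moreover have "exp (of_real l * log_angle \<zeta> (z n)) = (- 1) ^ Suc n" for n
  proof -
    have "l * t n = pi * of_nat (Suc n) \<or> l * t n = - (pi * of_nat (Suc n))"
      using l by (auto simp: t_def abs_if)
    moreover have "cis (pi * of_nat (Suc n)) = (- 1) ^ Suc n"
      using Complex.DeMoivre[of pi "Suc n"] unfolding cis_pi by (simp only: mult.commute[of pi])
    moreover have "cis (- (pi * of_nat (Suc n))) = (- 1) ^ Suc n"
      using calculation(2) by (metis cis_cnj complex_cnj_minus complex_cnj_one complex_cnj_power)
    ultimately have "cis (l * t n) = (- 1) ^ Suc n" by metis
    then show ?thesis unfolding zl exp_times_Complex by simp
  qed
  ultimately have lim: "(\<lambda>n. (- 1 :: complex) ^ Suc n) \<longlonglongrightarrow> L" by simp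
  from LIMSEQ_unique[OF tendsto_minus[OF lim]] LIMSEQ_Suc[OF lim] have "- L = L" by simp
  moreover have "(\<lambda>n. norm ((- 1 :: complex) ^ Suc n)) \<longlonglongrightarrow> norm L" by (intro tendsto_norm lim)
  then have "norm L = 1" by (simp add: norm_power LIMSEQ_const_iff)
  ultimately show False by auto
qed

text \<open>The Poisson integral fixes the real part, hence \<open>f\<close> up to an imaginary
  constant that goes into \<open>\<kappa>\<close>. In an index \<open>(i, e)\<close> the flag
  \<open>e\<close> selects the final or the initial endpoint of the arc, with opposite
  signs.\<close>

lemma holo_step_function_log_sum:
  assumes f: "holo_with_boundary_Re f (\<lambda>\<zeta>. \<Sum>i<n. c i * indicator (closed_arc (a i) (b i)) \<zeta>)"
    and ab: "\<And>i. i < n \<Longrightarrow> a i < b i \<and> b i < a i + 2 * pi"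
  obtains \<kappa> where "\<And>z. z \<in> unit_disk \<Longrightarrow>
     f z = log_sum ({..<n} \<times> UNIV) \<kappa> (\<lambda>(i, e). if e then c i / pi else - c i / pi)
             (\<lambda>(i, e). cis (if e then b i else a i)) z"
proof -
  let ?d = "\<lambda>(i, e). if e then c i / pi else - c i / pi" and ?s = "\<lambda>(i, e). cis (if e then b i else a i)"
  let ?I = "{..<n} \<times> (UNIV :: bool set)"
  \<comment> \<open>The harmonic measures of the arcs seen from 0, where all logarithms
    vanish.\<close>
  define \<kappa> where "\<kappa> = complex_of_real (\<Sum>i<n. c i * ((b i - a i) / (2 * pi)))"
  have "log_sum ?I \<kappa> ?d ?s holomorphic_on unit_disk"
    by (rule holomorphic_on_log_sum) auto
  moreover have "Re (f z) = Re (log_sum ?I \<kappa> ?d ?s z)" if z: "z \<in> unit_disk" for z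
  proof -
    have nz: "norm z < 1" using z by simp
    have "Re (f z) = poisson_integral (\<lambda>\<zeta>. \<Sum>i<n. c i * indicator (closed_arc (a i) (b i)) \<zeta>) z"
      using f z by (simp add: holo_with_boundary_Re_def)
    also have "\<dots> = (\<Sum>i<n. c i * poisson_integral (indicator (closed_arc (a i) (b i))) z)"
      by (rule poisson_integral_sum_arcs[OF nz])
    also have "\<dots> = (\<Sum>i<n. c i * ((b i - a i) / (2 * pi) + Re (log_angle (cis (b i)) z - log_angle (cis (a i)) z) / pi))"
      using ab by (intro sum.cong refl) (simp add: poisson_integral_arc[OF nz])
    also have "\<dots> = (\<Sum>i<n. c i * ((b i - a i) / (2 * pi)))
        + (\<Sum>i<n. \<Sum>e\<in>UNIV. Re (of_real (?d (i, e)) * log_angle (?s (i, e)) z))"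
      unfolding sum.distrib[symmetric]
      by (intro sum.cong refl) (simp add: UNIV_bool algebra_simps diff_divide_distrib)
    also have "\<dots> = Re (log_sum ?I \<kappa> ?d ?s z)"
      unfolding log_sum_def \<kappa>_def by (simp add: sum.cartesian_product case_prod_unfold cong: if_cong)
    finally show ?thesis .
  qed
  moreover have "f holomorphic_on unit_disk" using f by (simp add: holo_with_boundary_Re_def)
  ultimately obtain \<beta> where \<beta>: "\<And>z. z \<in> unit_disk \<Longrightarrow> f z = log_sum ?I \<kappa> ?d ?s z + \<i> * of_real \<beta>"
    using holomorphic_eq_Re_imp_diff_imaginary[of f "log_sum ?I \<kappa> ?d ?s"] by blast
  show thesis
    by (rule that[of "\<kappa> + \<i> * of_real \<beta>"]) (simp add: \<beta> log_sum_def)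
qed

lemma holo_arc_log_sum:
  assumes f: "holo_with_boundary_Re f (indicator (closed_arc a b))" and ab: "a < b" "b < a + 2 * pi"
  obtains \<kappa> where "\<And>z. z \<in> unit_disk \<Longrightarrow>
     f z = log_sum UNIV \<kappa> (\<lambda>e. if e then 1 / pi else - 1 / pi) (\<lambda>e. cis (if e then b else a)) z"
proof -
  have "holo_with_boundary_Re f (\<lambda>\<zeta>. \<Sum>i<Suc 0. 1 * indicator (closed_arc a b) \<zeta>)"
    using f by simp
  then obtain \<kappa> where \<kappa>: "\<And>z. z \<in> unit_disk \<Longrightarrow>
     f z = log_sum ({..<Suc 0} \<times> UNIV) \<kappa> (\<lambda>(i, e). if e then 1 / pi else - 1 / pi)
             (\<lambda>(i, e). cis (if e then b else a)) z"
    by (rule holo_step_function_log_sum) (use ab in auto)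
  have "{..<Suc 0} \<times> (UNIV :: bool set) = {(0, False), (0, True)}" by auto
  then show thesis
    by (intro that[of \<kappa>]) (simp add: \<kappa> log_sum_def UNIV_bool)
qed

lemma cis_arc_endpoints_neq:
  assumes "a < b" "b < a + 2 * pi"
  shows "cis a \<noteq> cis b"
proof
  assume "cis a = cis b"
  then have "cis b = cis a" by simp
  then obtain n :: int where n: "b = a + 2 * pi * of_int n" by (rule cis_eq_cisD)
  then have "2 * pi * 0 < 2 * pi * real_of_int n" "2 * pi * real_of_int n < 2 * pi * 1"
    using assms by simp_all
  then have "0 < real_of_int n" "real_of_int n < 1"
    by (simp_all only: mult_less_cancel_left_pos pi_gt_zero zero_less_mult_iff zero_less_numeral simp_thms)
  then have "0 < n" "n < 1" by simp_all
  then show False by linarith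
qed

text \<open>With the next lemma this shows that all real powers of an exponential generator are
  again generators.\<close>

lemma holo_with_boundary_Re_scale:
  assumes "holo_with_boundary_Re f u"
  shows "holo_with_boundary_Re (\<lambda>z. of_real m * f z) (\<lambda>\<zeta>. m * u \<zeta>)"
proof -
  have "poisson_integral (\<lambda>\<zeta>. m * u \<zeta>) z = m * poisson_integral u z" for z
  proof -
    have "(LBINT t:{0..2*pi}. poisson_kernel z t * (m * u (cis t))) = (LBINT t:{0..2*pi}. m * (poisson_kernel z t * u (cis t)))"
      by (simp add: mult.left_commute)
    then show ?thesis by (simp add: poisson_integral_def)
  qed
  then show ?thesis using assms unfolding holo_with_boundary_Re_def by (auto intro: holomorphic_intros)
qed

lemma arc_step_function_scale: "arc_step_function S u \<Longrightarrow> arc_step_function S (\<lambda>\<zeta>. m * u \<zeta>)"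
  unfolding arc_step_function_def
proof (elim exE conjE)
  fix n :: nat and c a b
  assume ab: "\<forall>i<n. a i < b i \<and> b i < a i + 2 * pi \<and> cis (a i) \<in> S \<and> cis (b i) \<in> S"
    and u: "u = (\<lambda>\<zeta>. \<Sum>i<n. c i * indicator (closed_arc (a i) (b i)) \<zeta>)"
  have eq: "(\<lambda>\<zeta>. m * u \<zeta>) = (\<lambda>\<zeta>. \<Sum>i<n. (m * c i) * indicator (closed_arc (a i) (b i)) \<zeta>)"
    unfolding u by (simp only: sum_distrib_left mult.assoc)
  show "\<exists>(n::nat) c a b. (\<forall>i<n. a i < b i \<and> b i < a i + 2 * pi \<and> cis (a i) \<in> S \<and> cis (b i) \<in> S) \<and>
      (\<lambda>\<zeta>. m * u \<zeta>) = (\<lambda>\<zeta>. \<Sum>i<n. c i * indicator (closed_arc (a i) (b i)) \<zeta>)"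
    by (rule exI[of _ n], rule exI[of _ "\<lambda>i. m * c i"], rule exI[of _ a], rule exI[of _ b], rule conjI[OF ab eq])
qed

lemma exp_generator_log_sum:
  assumes "arc_step_function S u" "holo_with_boundary_Re f u"
  obtains I :: "(nat \<times> bool) set" and \<kappa> d s where "finite I" "\<forall>i\<in>I. norm (s i) = 1"
    "\<And>z. z \<in> unit_disk \<Longrightarrow> f z = log_sum I \<kappa> d s z"
proof -
  obtain n :: nat and c a b where
    ab: "\<forall>i<n. a i < b i \<and> b i < a i + 2 * pi \<and> cis (a i) \<in> S \<and> cis (b i) \<in> S"
    and u: "u = (\<lambda>\<zeta>. \<Sum>i<n. c i * indicator (closed_arc (a i) (b i)) \<zeta>)"
    using assms(1) unfolding arc_step_function_def by blast
  obtain \<kappa> where \<kappa>: "\<And>z. z \<in> unit_disk \<Longrightarrow>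
     f z = log_sum ({..<n} \<times> UNIV) \<kappa> (\<lambda>(i, e). if e then c i / pi else - c i / pi)
             (\<lambda>(i, e). cis (if e then b i else a i)) z"
    by (rule holo_step_function_log_sum[OF assms(2)[unfolded u]]) (use ab in auto)
  show thesis by (rule that[OF _ _ \<kappa>]) auto
qed

section \<open>Limits and asymptotics of the two families of generators\<close>

lemma local_form_disk_algebra:
  assumes "k \<in> disk_algebra" "norm \<zeta> = 1"
  shows "\<exists>c. local_form k \<zeta> c 0"
  using disk_algebra_limit[of k \<zeta>] assms local_form_limit by auto

text \<open>The exceptional points of a generator are the finitely many endpoints of its arcs. If
  its exponent at \<open>\<zeta>\<close> is nonzero, its real powers realise every exponent.\<close>

lemma tame_algebra_exp:
  "tame_algebra (disk_algebra \<union> exp_generators S)"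
proof
  let ?G = "disk_algebra \<union> exp_generators S"
  have ls: "on_disk (\<lambda>z. exp (f z)) = on_disk (\<lambda>z. exp (log_sum I \<kappa> d s z))"
    if "\<And>z. z \<in> unit_disk \<Longrightarrow> f z = log_sum I \<kappa> d s z" for f and I :: "(nat \<times> bool) set" and \<kappa> d s
    using that by (intro on_disk_eqI) auto
  show "disk_algebra \<subseteq> ?G" by simp
  show Hinf: "?G \<subseteq> Hinf"
  proof (rule Un_least[OF disk_algebra_Hinf], rule subsetI)
    fix k assume "k \<in> exp_generators S"
    then obtain f u where f: "k = on_disk (\<lambda>z. exp (f z))" "arc_step_function S u" "holo_with_boundary_Re f u"
      unfolding exp_generators_def by blast
    obtain I :: "(nat \<times> bool) set" and \<kappa> d s where "finite I" "\<forall>i\<in>I. norm (s i) = 1"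
      "\<And>z. z \<in> unit_disk \<Longrightarrow> f z = log_sum I \<kappa> d s z"
      using exp_generator_log_sum[OF f(2,3)] by metis
    then show "k \<in> Hinf" unfolding f(1) by (subst ls) (auto intro: exp_log_sum_Hinf)
  qed
  interpret disk_function_algebra ?G by unfold_locales (simp, rule Hinf)
  fix k assume k: "k \<in> ?G"
  show "\<exists>F. finite F \<and> F \<subseteq> unit_circle \<and> (\<forall>\<zeta>\<in>unit_circle - F. \<exists>l. (k \<longlongrightarrow> l) (at \<zeta> within unit_disk))"
  proof (cases "k \<in> disk_algebra")
    case True
    then show ?thesis using disk_algebra_limit by (intro exI[of _ "{}"]) auto
  next
    case False
    then obtain f u where f: "k = on_disk (\<lambda>z. exp (f z))" "arc_step_function S u" "holo_with_boundary_Re f u"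
      using k unfolding exp_generators_def by blast
    obtain I :: "(nat \<times> bool) set" and \<kappa> d s where I: "finite I" and s: "\<forall>i\<in>I. norm (s i) = 1"
      and fl: "\<And>z. z \<in> unit_disk \<Longrightarrow> f z = log_sum I \<kappa> d s z"
      using exp_generator_log_sum[OF f(2,3)] by metis
    have "\<exists>l. (k \<longlongrightarrow> l) (at \<zeta> within unit_disk)" if \<zeta>: "\<zeta> \<in> unit_circle - s ` I" for \<zeta>
    proof -
      have n: "norm \<zeta> = 1" using \<zeta> by simp
      have e: "{i\<in>I. s i = \<zeta>} = {}" using \<zeta> by auto
      obtain c where "local_form (\<lambda>z. exp (log_sum I \<kappa> d s z)) \<zeta> c (\<Sum>i\<in>{i\<in>I. s i = \<zeta>}. d i)"
        using local_form_exp_log_sum[OF I s n, where \<kappa> = \<kappa> and d = d] by blast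
      then have "local_form (\<lambda>z. exp (log_sum I \<kappa> d s z)) \<zeta> c 0" unfolding e by simp
      then have "local_form k \<zeta> c 0"
        by (rule local_form_cong) (simp add: f fl on_disk_def)
      then show ?thesis using limit_local_form by blast
    qed
    then show ?thesis using I s by (intro exI[of _ "s ` I"]) auto
  qed
  fix \<zeta> :: complex assume \<zeta>: "norm \<zeta> = 1"
  show "\<exists>c l. local_form k \<zeta> c l \<and> (c \<noteq> 0 \<and> l \<noteq> 0 \<longrightarrow> (\<forall>m. \<exists>H\<in>alg. local_form H \<zeta> 1 m))"
  proof (cases "k \<in> disk_algebra")
    case True
    then show ?thesis using local_form_disk_algebra \<zeta> by blast
  next
    case False
    then obtain f u where f: "k = on_disk (\<lambda>z. exp (f z))" "arc_step_function S u" "holo_with_boundary_Re f u"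
      using k unfolding exp_generators_def by blast
    obtain I :: "(nat \<times> bool) set" and \<kappa> d s where I: "finite I" and s: "\<forall>i\<in>I. norm (s i) = 1"
      and fl: "\<And>z. z \<in> unit_disk \<Longrightarrow> f z = log_sum I \<kappa> d s z"
      using exp_generator_log_sum[OF f(2,3)] by metis
    define l where "l = (\<Sum>i\<in>{i\<in>I. s i = \<zeta>}. d i)"
    obtain c where c: "local_form (\<lambda>z. exp (log_sum I \<kappa> d s z)) \<zeta> c l"
      using local_form_exp_log_sum[OF I s \<zeta>, where \<kappa> = \<kappa> and d = d] unfolding l_def by blast
    have "local_form k \<zeta> c l"
      by (rule local_form_cong[OF c]) (simp add: f fl on_disk_def)
    moreover have "\<exists>H\<in>alg. local_form H \<zeta> 1 m" if l0: "l \<noteq> 0" for m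
    proof -
      \<comment> \<open>Scaling \<open>f\<close> by this factor turns the exponent \<open>l\<close>
        into \<open>m\<close>; the leading constant \<open>c'\<close> is divided out at the
        end.\<close>
      define r where "r = m / l"
      obtain c' where c': "c' \<noteq> 0" "local_form (\<lambda>z. exp (log_sum I (of_real r * \<kappa>) (\<lambda>i. r * d i) s z)) \<zeta> c' m"
      proof -
        have "(\<Sum>i\<in>{i\<in>I. s i = \<zeta>}. r * d i) = m"
          by (simp only: sum_distrib_left[symmetric] l_def[symmetric]) (simp add: r_def l0)
        then show thesis
          using local_form_exp_log_sum[OF I s \<zeta>, where \<kappa> = "of_real r * \<kappa>" and d = "\<lambda>i. r * d i"] that
          by metis
      qed
      let ?E = "on_disk (\<lambda>z. exp (of_real r * f z))"
      have "?E \<in> exp_generators S"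
        unfolding exp_generators_def
        by (intro CollectI exI[of _ "\<lambda>z. of_real r * f z"] exI[of _ "\<lambda>\<zeta>. r * u \<zeta>"] conjI refl
            arc_step_function_scale[OF f(2)] holo_with_boundary_Re_scale[OF f(3)])
      then have "(\<lambda>z. inverse c' * ?E z) \<in> alg" by (intro alg_scale gens_alg) simp
      moreover have "local_form ?E \<zeta> c' m"
        by (rule local_form_cong[OF c'(2)]) (simp add: on_disk_def fl log_sum_scale)
      then have "local_form (\<lambda>z. inverse c' * ?E z) \<zeta> (inverse c' * c') m" by (rule local_form_scale)
      ultimately show ?thesis using c'(1) by auto
    qed
    ultimately show ?thesis by blast
  qed
qed

text \<open>The arc may have a second endpoint away from \<open>s\<^sub>0\<close>, but there the
  continuity of \<open>g * exp f\<close> forces \<open>g\<close> to tend to 0. So each generator can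
  be discontinuous at \<open>s\<^sub>0\<close> only, where the multiples of \<open>f\<close> supply
  all exponents.\<close>

lemma tame_algebra_point:
  assumes "s\<^sub>0 \<in> unit_circle"
  shows "tame_algebra (disk_algebra \<union> point_generators {s\<^sub>0})"
proof
  let ?G = "disk_algebra \<union> point_generators {s\<^sub>0}"
  let ?d = "\<lambda>e. if e then 1 / pi else - 1 / pi :: real"
  \<comment> \<open>The conditions on \<open>g\<close> and \<open>f\<close> do not involve
    \<open>lam\<close>, so the multiplier can be replaced by any real \<open>m\<close> within the
    same family.\<close>
  have data: "\<exists>g lam f \<kappa> s. k = on_disk (\<lambda>z. g z * exp (of_real lam * f z)) \<and> g \<in> disk_algebra \<and>
      (\<forall>m. on_disk (\<lambda>z. g z * exp (of_real m * f z)) \<in> point_generators {s\<^sub>0}) \<and>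
      (\<forall>e. norm (s e) = 1) \<and> s True \<noteq> s False \<and>
      (\<forall>z\<in>unit_disk. f z = log_sum (UNIV :: bool set) \<kappa> ?d s z) \<and>
      (\<forall>\<zeta>. norm \<zeta> = 1 \<and> \<zeta> \<noteq> s\<^sub>0 \<longrightarrow> (\<exists>l. ((\<lambda>z. g z * exp (f z)) \<longlongrightarrow> l) (at \<zeta> within unit_disk)))"
    if k: "k \<in> point_generators {s\<^sub>0}" for k
  proof -
    obtain g lam f a b where f: "k = on_disk (\<lambda>z. g z * exp (of_real lam * f z))" "g \<in> disk_algebra"
        "a < b" "b < a + 2 * pi" "cis a \<in> {s\<^sub>0} \<or> cis b \<in> {s\<^sub>0}"
        "holo_with_boundary_Re f (indicator (closed_arc a b))"
        "boundary_discontinuities (\<lambda>z. g z * exp (f z)) = {s\<^sub>0}"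
      using k unfolding point_generators_def by blast
    obtain \<kappa> where \<kappa>: "\<And>z. z \<in> unit_disk \<Longrightarrow> f z = log_sum UNIV \<kappa> ?d (\<lambda>e. cis (if e then b else a)) z"
      by (rule holo_arc_log_sum[OF f(6,3,4)]) blast
    have "on_disk (\<lambda>z. g z * exp (of_real m * f z)) \<in> point_generators {s\<^sub>0}" for m
      unfolding point_generators_def using f by blast
    moreover have "\<exists>l. ((\<lambda>z. g z * exp (f z)) \<longlongrightarrow> l) (at \<zeta> within unit_disk)"
      if "norm \<zeta> = 1" "\<zeta> \<noteq> s\<^sub>0" for \<zeta>
    proof -
      have "\<zeta> \<notin> boundary_discontinuities (\<lambda>z. g z * exp (f z))" using f(7) that by simp
      then show ?thesis using that by (simp add: boundary_discontinuities_def)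
    qed
    ultimately show ?thesis
      using f(1,2) \<kappa> cis_arc_endpoints_neq[OF f(3,4)]
      by (intro exI[of _ g] exI[of _ lam] exI[of _ f] exI[of _ \<kappa>] exI[of _ "\<lambda>e. cis (if e then b else a)"]) auto
  qed
  have lam_sum: "exp (of_real m * f z) = exp (log_sum (UNIV :: bool set) (of_real m * \<kappa>) (\<lambda>e. m * ?d e) s z)"
    if "\<forall>z\<in>unit_disk. f z = log_sum (UNIV :: bool set) \<kappa> ?d s z" "z \<in> unit_disk" for m f \<kappa> s z
    using that by (simp add: log_sum_scale)
  show "disk_algebra \<subseteq> ?G" by simp
  show Hinf: "?G \<subseteq> Hinf"
  proof (rule Un_least[OF disk_algebra_Hinf], rule subsetI)
    fix k assume "k \<in> point_generators {s\<^sub>0}"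
    from data[OF this] obtain g lam f \<kappa> and s :: "bool \<Rightarrow> complex" where
      k: "k = on_disk (\<lambda>z. g z * exp (of_real lam * f z))" "g \<in> disk_algebra"
      and s: "\<forall>e. norm (s e) = 1" and fl: "\<forall>z\<in>unit_disk. f z = log_sum UNIV \<kappa> ?d s z" by blast
    have "k = (\<lambda>z. g z * on_disk (\<lambda>z. exp (log_sum UNIV (of_real lam * \<kappa>) (\<lambda>e. lam * ?d e) s z)) z)"
      unfolding k by (auto simp: on_disk_def fun_eq_iff lam_sum[OF fl])
    also have "\<dots> \<in> Hinf"
      using k(2) disk_algebra_Hinf s by (intro Hinf_mult exp_log_sum_Hinf) auto
    finally show "k \<in> Hinf" .
  qed
  interpret disk_function_algebra ?G by unfold_locales (simp, rule Hinf)
  \<comment> \<open>\<open>c\<^sub>0\<close> is the boundary value of \<open>g\<close> and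
    \<open>l\<close> the exponent of \<open>exp f\<close> at \<open>\<zeta>\<close>. Both are
    independent of \<open>m\<close>, so the continuity condition for \<open>m = 1\<close> settles
    all multipliers.\<close>
  have loc: "\<exists>c\<^sub>0 l. (\<forall>m. \<exists>c. c \<noteq> 0 \<and> local_form (on_disk (\<lambda>z. g z * exp (of_real m * f z))) \<zeta> (c\<^sub>0 * c) (m * l)) \<and>
       (\<zeta> \<noteq> s\<^sub>0 \<longrightarrow> c\<^sub>0 = 0 \<or> l = 0)"
    if g: "g \<in> disk_algebra" and s: "\<forall>e. norm (s e) = 1" "s True \<noteq> s False"
      and fl: "\<forall>z\<in>unit_disk. f z = log_sum (UNIV :: bool set) \<kappa> ?d s z"
      and lim: "\<forall>\<zeta>. norm \<zeta> = 1 \<and> \<zeta> \<noteq> s\<^sub>0 \<longrightarrow> (\<exists>l. ((\<lambda>z. g z * exp (f z)) \<longlongrightarrow> l) (at \<zeta> within unit_disk))"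
      and \<zeta>: "norm \<zeta> = 1"
    for g f \<kappa> s \<zeta>
  proof -
    obtain c\<^sub>0 where c0: "local_form g \<zeta> c\<^sub>0 0" using local_form_disk_algebra[OF g \<zeta>] by blast
    define l where "l = (\<Sum>e\<in>{e\<in>UNIV. s e = \<zeta>}. ?d e)"
    have sn: "\<forall>e\<in>UNIV. norm (s e) = 1" using s by blast
    have ex: "\<exists>c. c \<noteq> 0 \<and> local_form (\<lambda>z. exp (of_real m * f z)) \<zeta> c (m * l)" for m
    proof -
      obtain c where c: "c \<noteq> 0" "local_form (\<lambda>z. exp (log_sum (UNIV :: bool set) (of_real m * \<kappa>) (\<lambda>e. m * ?d e) s z)) \<zeta> c
          (\<Sum>e\<in>{e\<in>UNIV. s e = \<zeta>}. m * ?d e)"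
        by (rule local_form_exp_log_sum[where I = UNIV and s = s and \<kappa> = "of_real m * \<kappa>" and d = "\<lambda>e. m * ?d e", OF finite sn \<zeta>])
           (rule that)
      have "(\<Sum>e\<in>{e\<in>UNIV. s e = \<zeta>}. m * ?d e) = m * l" by (simp add: l_def sum_distrib_left)
      with c(2) have "local_form (\<lambda>z. exp (log_sum UNIV (of_real m * \<kappa>) (\<lambda>e. m * ?d e) s z)) \<zeta> c (m * l)"
        by (simp only:)
      then have "local_form (\<lambda>z. exp (of_real m * f z)) \<zeta> c (m * l)"
        by (rule local_form_cong) (rule lam_sum[OF fl])
      with c(1) show ?thesis by blast
    qed
    have "\<exists>c. c \<noteq> 0 \<and> local_form (on_disk (\<lambda>z. g z * exp (of_real m * f z))) \<zeta> (c\<^sub>0 * c) (m * l)" for m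
    proof -
      obtain c where c: "c \<noteq> 0" "local_form (\<lambda>z. exp (of_real m * f z)) \<zeta> c (m * l)" using ex by blast
      have "local_form (on_disk (\<lambda>z. g z * exp (of_real m * f z))) \<zeta> (c\<^sub>0 * c) (0 + m * l)"
        by (rule local_form_cong[OF local_form_mult[OF \<zeta> c0 c(2)]]) (simp add: on_disk_def)
      with c(1) show ?thesis by auto
    qed
    \<comment> \<open>Otherwise the limit of \<open>g * exp f\<close> could be divided by the
      nonzero constant \<open>c\<^sub>0 * c\<close>, giving a limit for the oscillating model
      function.\<close>
    moreover have "c\<^sub>0 = 0 \<or> l = 0" if ne: "\<zeta> \<noteq> s\<^sub>0"
    proof (rule ccontr)
      assume "\<not> (c\<^sub>0 = 0 \<or> l = 0)"
      then have nz: "c\<^sub>0 \<noteq> 0" "l \<noteq> 0" by auto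
      obtain c where c: "c \<noteq> 0" "local_form (\<lambda>z. exp (f z)) \<zeta> c l" using ex[of 1] by auto
      obtain L where L: "((\<lambda>z. g z * exp (f z)) \<longlongrightarrow> L) (at \<zeta> within unit_disk)"
        using lim \<zeta> ne by blast
      have "local_form (\<lambda>z. g z * exp (f z)) \<zeta> (c\<^sub>0 * c) (0 + l)" by (rule local_form_mult[OF \<zeta> c0 c(2)])
      then have "((\<lambda>z. g z * exp (f z) - (c\<^sub>0 * c) * exp (of_real l * log_angle \<zeta> z)) \<longlongrightarrow> 0) (at \<zeta> within unit_disk)"
        by (simp add: local_form_def)
      from tendsto_diff[OF L this]
      have lim': "((\<lambda>z. (c\<^sub>0 * c) * exp (of_real l * log_angle \<zeta> z)) \<longlongrightarrow> L) (at \<zeta> within unit_disk)" by simp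
      have cancel: "inverse (c\<^sub>0 * c) * ((c\<^sub>0 * c) * w) = w" for w
        using nz(1) c(1) by (simp add: field_simps)
      from tendsto_mult_left[OF lim', of "inverse (c\<^sub>0 * c)"]
      have "((\<lambda>z. exp (of_real l * log_angle \<zeta> z)) \<longlongrightarrow> inverse (c\<^sub>0 * c) * L) (at \<zeta> within unit_disk)"
        by (simp only: cancel)
      then show False using exp_log_angle_no_limit[OF \<zeta> nz(2)] by blast
    qed
    ultimately show ?thesis by blast
  qed
  fix k assume k: "k \<in> ?G"
  show "\<exists>F. finite F \<and> F \<subseteq> unit_circle \<and> (\<forall>\<zeta>\<in>unit_circle - F. \<exists>l. (k \<longlongrightarrow> l) (at \<zeta> within unit_disk))"
  proof (cases "k \<in> disk_algebra")
    case True
    then show ?thesis using disk_algebra_limit by (intro exI[of _ "{}"]) auto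
  next
    case False
    then have "k \<in> point_generators {s\<^sub>0}" using k by blast
    from data[OF this] obtain g lam f \<kappa> and s :: "bool \<Rightarrow> complex" where
      kk: "k = on_disk (\<lambda>z. g z * exp (of_real lam * f z))" and g: "g \<in> disk_algebra"
      and s: "\<forall>e. norm (s e) = 1" "s True \<noteq> s False" and fl: "\<forall>z\<in>unit_disk. f z = log_sum UNIV \<kappa> ?d s z"
      and lim: "\<forall>\<zeta>. norm \<zeta> = 1 \<and> \<zeta> \<noteq> s\<^sub>0 \<longrightarrow> (\<exists>l. ((\<lambda>z. g z * exp (f z)) \<longlongrightarrow> l) (at \<zeta> within unit_disk))"
      by blast
    have "\<exists>l. (k \<longlongrightarrow> l) (at \<zeta> within unit_disk)" if \<zeta>: "\<zeta> \<in> unit_circle - {s\<^sub>0}" for \<zeta>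
    proof -
      have n: "norm \<zeta> = 1" "\<zeta> \<noteq> s\<^sub>0" using \<zeta> by auto
      obtain c\<^sub>0 l where cl: "\<forall>m. \<exists>c. c \<noteq> 0 \<and> local_form (on_disk (\<lambda>z. g z * exp (of_real m * f z))) \<zeta> (c\<^sub>0 * c) (m * l)"
          "c\<^sub>0 = 0 \<or> l = 0"
        using loc[OF g s fl lim n(1)] n(2) by blast
      then obtain c where "local_form k \<zeta> (c\<^sub>0 * c) (lam * l)" unfolding kk by blast
      then have "(k \<longlongrightarrow> c\<^sub>0 * c) (at \<zeta> within unit_disk)"
        by (rule limit_local_form) (use cl(2) in auto)
      then show ?thesis by blast
    qed
    then show ?thesis using assms by (intro exI[of _ "{s\<^sub>0}"]) auto
  qed
  fix \<zeta> :: complex assume \<zeta>: "norm \<zeta> = 1"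
  show "\<exists>c l. local_form k \<zeta> c l \<and> (c \<noteq> 0 \<and> l \<noteq> 0 \<longrightarrow> (\<forall>m. \<exists>H\<in>alg. local_form H \<zeta> 1 m))"
  proof (cases "k \<in> disk_algebra")
    case True
    then show ?thesis using local_form_disk_algebra \<zeta> by blast
  next
    case False
    then have "k \<in> point_generators {s\<^sub>0}" using k by blast
    from data[OF this] obtain g lam f \<kappa> and s :: "bool \<Rightarrow> complex" where
      kk: "k = on_disk (\<lambda>z. g z * exp (of_real lam * f z))" and g: "g \<in> disk_algebra"
      and pg: "\<forall>m. on_disk (\<lambda>z. g z * exp (of_real m * f z)) \<in> point_generators {s\<^sub>0}"
      and s: "\<forall>e. norm (s e) = 1" "s True \<noteq> s False" and fl: "\<forall>z\<in>unit_disk. f z = log_sum UNIV \<kappa> ?d s z"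
      and lim: "\<forall>\<zeta>. norm \<zeta> = 1 \<and> \<zeta> \<noteq> s\<^sub>0 \<longrightarrow> (\<exists>l. ((\<lambda>z. g z * exp (f z)) \<longlongrightarrow> l) (at \<zeta> within unit_disk))"
      by blast
    obtain c\<^sub>0 l where cl: "\<forall>m. \<exists>c. c \<noteq> 0 \<and> local_form (on_disk (\<lambda>z. g z * exp (of_real m * f z))) \<zeta> (c\<^sub>0 * c) (m * l)"
      using loc[OF g s fl lim \<zeta>] by blast
    obtain c where "local_form k \<zeta> (c\<^sub>0 * c) (lam * l)" using cl unfolding kk by blast
    moreover have "\<exists>H\<in>alg. local_form H \<zeta> 1 m" if "c\<^sub>0 * c \<noteq> 0 \<and> lam * l \<noteq> 0" for m
    proof -
      \<comment> \<open>The multiplier \<open>m / l\<close> produces the exponent \<open>m\<close>;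
        the factor \<open>g\<close> stays, which is harmless as its boundary value
        \<open>c\<^sub>0\<close> is nonzero here.\<close>
      let ?E = "on_disk (\<lambda>z. g z * exp (of_real (m / l) * f z))"
      obtain c' where c': "c' \<noteq> 0" "local_form ?E \<zeta> (c\<^sub>0 * c') (m / l * l)" using cl by blast
      then have "local_form (\<lambda>z. inverse (c\<^sub>0 * c') * ?E z) \<zeta> (inverse (c\<^sub>0 * c') * (c\<^sub>0 * c')) (m / l * l)"
        by (intro local_form_scale)
      moreover have "inverse (c\<^sub>0 * c') * (c\<^sub>0 * c') = 1" "m / l * l = m"
        using that c'(1) by (auto simp: field_simps)
      ultimately have "local_form (\<lambda>z. inverse (c\<^sub>0 * c') * ?E z) \<zeta> 1 m" by (simp only:)
      moreover have "(\<lambda>z. inverse (c\<^sub>0 * c') * ?E z) \<in> alg" using pg by (intro alg_scale gens_alg) blast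
      ultimately show ?thesis by blast
    qed
    ultimately show ?thesis by blast
  qed
qed

section \<open>Density of the disk for the algebras \<open>A_alg S\<close>\<close>

theorem theorem1p11:
  fixes S :: "complex set"
  assumes "S \<noteq> {}" and "closed S" and "S \<subseteq> unit_circle"
  shows "point_eval (A_alg S) ` unit_disk \<subseteq> max_ideal_space (A_alg S)
    \<and> gelfand_topology (A_alg S) closure_of (point_eval (A_alg S) ` unit_disk)
        = max_ideal_space (A_alg S)"
proof -
  let ?G = "disk_algebra \<union> (if is_singleton S then point_generators S else exp_generators S)"
  interpret tame_algebra ?G
  proof (cases "is_singleton S")
    case True
    then obtain s\<^sub>0 where "S = {s\<^sub>0}" by (auto simp: is_singleton_def)
    then show "tame_algebra ?G" using tame_algebra_point[of s\<^sub>0] assms(3) by simp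
  next
    case False
    then show "tame_algebra ?G" using tame_algebra_exp[of S] by simp
  qed
  have "A_alg S = alg" unfolding A_alg_def alg_def ..
  then show ?thesis using point_eval_in_max_ideal_space disk_dense_in_max_ideal_space by auto
qed

end
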